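(* For solutions $(\phi,\mathbf u)$ to the coupled system consisting of the elasticity problem $$\begin{cases}-\nabla\cdot(\mathbf E(\phi)\varepsilon(\mathbf u))=\mathbf f(\phi)&\text{in }\Omega,\\ \mathbf u=\mathbf 0&\text{on }\Gamma_D,\\ \mathbf E(\phi)\varepsilon(\mathbf u)\cdot\mathbf n=\mathbf s&\text{on }\Gamma_T,\\ \mathbf E(\phi)\varepsilon(\mathbf u)\cdot\mathbf n=\mathbf 0&\text{on }\partial\Omega\setminus(\Gamma_D\cup\Gamma_T),\end{cases}$$ and the constrained gradient flow $$\begin{cases}\dfrac{\partial\phi}{\partial t}=\gamma\epsilon\Delta\phi-\dfrac{\gamma}{\epsilon}F'(\phi)+\mathbf E'(\phi)\varepsilon(\mathbf u):\varepsilon(\mathbf u)-2\mathbf f'(\phi)\cdot\mathbf u-\lambda-\eta(1-2\phi)&\text{in }\Omega,\ t>0,\\ \phi(\mathbf x,0)=\phi^0(\mathbf x)&\text{in }\Omega,\\ \dfrac{\partial\phi}{\partial\mathbf n}=0&\text{on }\partial\Omega,\\ \lambda\ge0,\quad \int_\Omega\phi\,d\mathbf x-V_0=0,\quad \lambda\big(\int_\Omega\phi\,d\mathbf x-V_0\big)=0,\\ \eta\ge0,\quad \phi(1-\phi)\ge0,\quad \eta\,\phi(1-\phi)=0,\end{cases}$$ the functional $$J(\phi,\mathbf u)=\int_{\Gamma_T}\mathbf s\cdot\mathbf u\,ds+\int_\Omega \mathbf f(\phi)\cdot\mathbf u\,d\mathbf x+\gamma\int_\Omega\Big(\frac{\epsilon}{2}|\nabla\phi|^2+\frac1\epsilon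 F(\phi)\Big)\,d\mathbf x$$ satisfies $$\frac{d J(\phi,\mathbf u(\phi))}{dt}=-\|\phi_t\|^2\le0,\qquad t>0.$$
   Context: Let $d\in\{2,3\}$ and let $\Omega\subset\mathbb R^d$ be a fixed design domain with boundary $\partial\Omega$ and unit normal $\mathbf n$. $\Gamma_D\subset\partial\Omega$ is the Dirichlet boundary and $\Gamma_T\subset\partial\Omega$ is the Neumann boundary, on which a fixed surface traction $\mathbf s$ acts; $\mathbf f^0$ is a fixed given body force. The unknowns are the phase-field order parameter $\phi(\mathbf x,t)$, with initial value $\phi^0$, and the displacement $\mathbf u=\mathbf u(\phi)\in\mathcal V=\{\mathbf v\in H^1(\Omega)^d:\mathbf v|_{\Gamma_D}=\mathbf 0\}$, which solves the elasticity problem for the current $\phi$. The Lagrange multipliers are $\lambda=\lambda(t)\in\mathbb R$, depending only on time, for the volume constraint, and $\eta=\eta(\mathbf x,t)$, depending on space and time, with $\eta\in L^2(\Omega\times\mathbb R^+)$, for the bound constraint $0\le\phi\le1$. Constants: $\gamma>0$, interface thickness $\epsilon>0$, $0<E_{\min}\ll1$, $0<f_{\min}\ll1$, $p=3$, $\beta\in(0,1)$, $V_0=\beta|\Omega|$. Strain: $\varepsilon(\mathbf u)=\frac12(\nabla\mathbf u+(\nabla\mathbf u)^T)$. $\mathbf E^0$ is the constant, positive-definite, isotropic stiffness tensor $\mathbf E^0\varepsilon(\mathbf u)=\lambda_0\,\mathrm{tr}(\varepsilon(\mathbf u))\mathbf I+2\mu_0\,\varepsilon(\mathbf u)$, with Lamé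 constants $\mu_0=\frac{E}{2(1+\nu)}$ and $\lambda_0=\frac{E\nu}{(1+\nu)(1-\nu)}$ if $d=2$, $\lambda_0=\frac{E\nu}{(1+\nu)(1-2\nu)}$ if $d=3$, where $E>0$ is Young's modulus and $\nu\in(0,0.5)$ is Poisson's ratio. Interpolations: $\mathbf E(\phi)=\big(E_{\min}+(1-E_{\min})\phi^p\big)\mathbf E^0$ and $\mathbf f(\phi)=\big(f_{\min}+(1-f_{\min})\phi^p\big)\mathbf f^0$. Double-well potential: $F(\phi)=\frac14\phi^2(1-\phi)^2$. Primes denote derivatives with respect to $\phi$, $\phi_t=\partial\phi/\partial t$, and $\|\cdot\|$ is the $L^2(\Omega)$ norm. *)

theory Defs
  imports "HOL-Analysis.Analysis"
begin

section \<open>Domains and surface measure\<close>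

text \<open>Near each boundary point the domain is the region above a Lipschitz graph over the hyperplane
  orthogonal to \<open>e\<close>; the graph function is extended to the whole space constantly along \<open>e\<close>.\<close>

definition lipschitz_domain :: "(real^'d) set \<Rightarrow> bool" where
  "lipschitz_domain \<Omega> \<longleftrightarrow>
     open \<Omega> \<and> connected \<Omega> \<and> bounded \<Omega> \<and> \<Omega> \<noteq> {} \<and>
     (\<forall>p\<in>frontier \<Omega>. \<exists>r>0. \<exists>e g L. norm e = 1 \<and> lipschitz_on L UNIV g \<and>
        (\<forall>x c. g (x + c *\<^sub>R e) = g x) \<and> \<Omega> \<inter> ball p r = {x \<in> ball p r. g x < x \<bullet> e})"

text \<open>The Hausdorff measure of integer dimension \<open>k\<close>, normalised so that it agrees with Lebesgue measure
  on \<open>k\<close>-dimensional planes. The outer measure is a metric outer measure, hence countably additive on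
  the Borel sets.\<close>

definition hausdorff_content :: "nat \<Rightarrow> real \<Rightarrow> 'a::metric_space set \<Rightarrow> ennreal" where
  "hausdorff_content k \<delta> A =
     (INF S\<in>{S :: nat \<Rightarrow> 'a set. A \<subseteq> (\<Union>i. S i) \<and> (\<forall>i. bounded (S i) \<and> diameter (S i) \<le> \<delta>)}.
        \<Sum>i. ennreal (unit_ball_vol (real k) * (diameter (S i) / 2) ^ k))"

definition hausdorff_outer :: "nat \<Rightarrow> 'a::metric_space set \<Rightarrow> ennreal" where
  "hausdorff_outer k A = (SUP \<delta>\<in>{0<..}. hausdorff_content k \<delta> A)"

definition hausdorff_measure :: "nat \<Rightarrow> 'a::metric_space measure" where
  "hausdorff_measure k = measure_of UNIV (sets borel) (hausdorff_outer k)"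

definition surface :: "(real^'d) set \<Rightarrow> (real^'d) measure" where
  "surface \<Gamma> = restrict_space (hausdorff_measure (CARD('d) - 1)) \<Gamma>"


section \<open>Square-integrable functions\<close>

definition square_integrable :: "'a measure \<Rightarrow> ('a \<Rightarrow> 'b::real_normed_vector) \<Rightarrow> bool" where
  "square_integrable M f \<longleftrightarrow> f \<in> borel_measurable M \<and> integrable M (\<lambda>x. (norm (f x))\<^sup>2)"

definition L2_norm_on :: "(real^'d) set \<Rightarrow> (real^'d \<Rightarrow> real) \<Rightarrow> real" where
  "L2_norm_on \<Omega> f = sqrt (\<integral>x. (f x)\<^sup>2 \<partial>lebesgue_on \<Omega>)"

definition L2_tendsto ::
  "'a measure \<Rightarrow> ('i \<Rightarrow> 'a \<Rightarrow> 'b::real_normed_vector) \<Rightarrow> ('a \<Rightarrow> 'b) \<Rightarrow> 'i filter \<Rightarrow> bool" where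
  "L2_tendsto M f g F \<longleftrightarrow> ((\<lambda>i. \<integral>\<^sup>+x. ennreal ((norm (f i x - g x))\<^sup>2) \<partial>M) \<longlongrightarrow> 0) F"


section \<open>Weak derivatives, traces and normal traces\<close>

definition C1_with_gradient :: "(real^'d \<Rightarrow> real) \<Rightarrow> (real^'d \<Rightarrow> real^'d) \<Rightarrow> bool" where
  "C1_with_gradient \<psi> D \<longleftrightarrow> (\<forall>x. GDERIV \<psi> x :> D x) \<and> continuous_on UNIV D"

text \<open>\<open>C\<^sup>1\<close> test functions of compact support determine the same weak derivatives as smooth ones.\<close>

definition test_function :: "(real^'d) set \<Rightarrow> (real^'d \<Rightarrow> real) \<Rightarrow> (real^'d \<Rightarrow> real^'d) \<Rightarrow> bool" where
  "test_function \<Omega> \<psi> D \<longleftrightarrow> C1_with_gradient \<psi> D \<and>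
     compact (closure {x. \<psi> x \<noteq> 0}) \<and> closure {x. \<psi> x \<noteq> 0} \<subseteq> \<Omega>"

definition has_weak_gradient :: "(real^'d) set \<Rightarrow> (real^'d \<Rightarrow> real) \<Rightarrow> (real^'d \<Rightarrow> real^'d) \<Rightarrow> bool" where
  "has_weak_gradient \<Omega> v G \<longleftrightarrow>
     square_integrable (lebesgue_on \<Omega>) v \<and> square_integrable (lebesgue_on \<Omega>) G \<and>
     (\<forall>\<psi> D. test_function \<Omega> \<psi> D \<longrightarrow>
        (\<integral>x. v x *\<^sub>R D x \<partial>lebesgue_on \<Omega>) = - (\<integral>x. \<psi> x *\<^sub>R G x \<partial>lebesgue_on \<Omega>))"

definition H1 :: "(real^'d) set \<Rightarrow> (real^'d \<Rightarrow> real) set" where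
  "H1 \<Omega> = {v. \<exists>G. has_weak_gradient \<Omega> v G}"

text \<open>Weak gradients, weak divergences and traces are unique up to null sets; the operators below pick
  one representative.\<close>

definition wgrad :: "(real^'d) set \<Rightarrow> (real^'d \<Rightarrow> real) \<Rightarrow> real^'d \<Rightarrow> real^'d" where
  "wgrad \<Omega> v = (SOME G. has_weak_gradient \<Omega> v G)"

definition wjac :: "(real^'d) set \<Rightarrow> (real^'d \<Rightarrow> real^'d) \<Rightarrow> real^'d \<Rightarrow> real^'d^'d" where
  "wjac \<Omega> u x = (\<chi> i. wgrad \<Omega> (\<lambda>y. u y $ i) x)"

text \<open>The divergence is only required to be integrable, since \<open>E'(\<phi>) \<epsilon>(u) : \<epsilon>(u)\<close> and hence the Laplacian
  of the order parameter need not be square integrable when \<open>u\<close> is merely an \<open>H\<^sup>1\<close> field.\<close>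

definition has_weak_divergence :: "(real^'d) set \<Rightarrow> (real^'d \<Rightarrow> real^'d) \<Rightarrow> (real^'d \<Rightarrow> real) \<Rightarrow> bool" where
  "has_weak_divergence \<Omega> \<tau> q \<longleftrightarrow>
     square_integrable (lebesgue_on \<Omega>) \<tau> \<and> integrable (lebesgue_on \<Omega>) q \<and>
     (\<forall>\<psi> D. test_function \<Omega> \<psi> D \<longrightarrow>
        (\<integral>x. \<tau> x \<bullet> D x \<partial>lebesgue_on \<Omega>) = - (\<integral>x. q x * \<psi> x \<partial>lebesgue_on \<Omega>))"

definition weakly_divergent :: "(real^'d) set \<Rightarrow> (real^'d \<Rightarrow> real^'d) \<Rightarrow> bool" where
  "weakly_divergent \<Omega> \<tau> \<longleftrightarrow> (\<exists>q. has_weak_divergence \<Omega> \<tau> q)"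

definition wdiv :: "(real^'d) set \<Rightarrow> (real^'d \<Rightarrow> real^'d) \<Rightarrow> real^'d \<Rightarrow> real" where
  "wdiv \<Omega> \<tau> = (SOME q. has_weak_divergence \<Omega> \<tau> q)"

definition wlaplacian :: "(real^'d) set \<Rightarrow> (real^'d \<Rightarrow> real) \<Rightarrow> real^'d \<Rightarrow> real" where
  "wlaplacian \<Omega> v = wdiv \<Omega> (wgrad \<Omega> v)"

text \<open>The trace is the continuous extension of restriction to the boundary: approximate in \<open>H\<^sup>1\<close> by
  functions that are \<open>C\<^sup>1\<close> up to the boundary.\<close>

definition has_trace :: "(real^'d) set \<Rightarrow> (real^'d \<Rightarrow> real) \<Rightarrow> (real^'d \<Rightarrow> real) \<Rightarrow> bool" where
  "has_trace \<Omega> v w \<longleftrightarrow> square_integrable (surface (frontier \<Omega>)) w \<and>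
     (\<exists>\<psi> D. (\<forall>n::nat. C1_with_gradient (\<psi> n) (D n)) \<and>
        L2_tendsto (lebesgue_on \<Omega>) \<psi> v sequentially \<and>
        L2_tendsto (lebesgue_on \<Omega>) D (wgrad \<Omega> v) sequentially \<and>
        L2_tendsto (surface (frontier \<Omega>)) \<psi> w sequentially)"

definition btrace :: "(real^'d) set \<Rightarrow> (real^'d \<Rightarrow> real) \<Rightarrow> real^'d \<Rightarrow> real" where
  "btrace \<Omega> v = (SOME w. has_trace \<Omega> v w)"

definition btrace_vec :: "(real^'d) set \<Rightarrow> (real^'d \<Rightarrow> real^'d) \<Rightarrow> real^'d \<Rightarrow> real^'d" where
  "btrace_vec \<Omega> u x = (\<chi> i. btrace \<Omega> (\<lambda>y. u y $ i) x)"

text \<open>\<open>\<tau> \<cdot> n = g\<close> on \<open>\<Gamma>\<close>. A field that is only square integrable with integrable divergence has no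
  pointwise boundary values, so \<open>\<tau> \<cdot> n\<close> is the usual normal trace, defined by Green's formula against
  the functions vanishing on the rest of the boundary. On a Lipschitz domain and for \<open>\<tau>\<close> smooth up to
  the boundary this is the pointwise product with the outer unit normal \<open>n\<close>.\<close>

definition has_normal_trace ::
  "(real^'d) set \<Rightarrow> (real^'d) set \<Rightarrow> (real^'d \<Rightarrow> real^'d) \<Rightarrow> (real^'d \<Rightarrow> real) \<Rightarrow> bool" where
  "has_normal_trace \<Omega> \<Gamma> \<tau> g \<longleftrightarrow> weakly_divergent \<Omega> \<tau> \<and>
     (\<forall>v\<in>H1 \<Omega>. (AE x in surface (frontier \<Omega> - \<Gamma>). btrace \<Omega> v x = 0) \<longrightarrow>
        integrable (lebesgue_on \<Omega>) (\<lambda>x. wdiv \<Omega> \<tau> x * v x) \<longrightarrow>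
        (\<integral>x. \<tau> x \<bullet> wgrad \<Omega> v x \<partial>lebesgue_on \<Omega>) + (\<integral>x. wdiv \<Omega> \<tau> x * v x \<partial>lebesgue_on \<Omega>)
          = (\<integral>x. g x * btrace \<Omega> v x \<partial>surface \<Gamma>))"


section \<open>Elasticity with phase-field interpolated material\<close>

definition strain :: "(real^'d) set \<Rightarrow> (real^'d \<Rightarrow> real^'d) \<Rightarrow> real^'d \<Rightarrow> real^'d^'d" where
  "strain \<Omega> u x = (1/2) *\<^sub>R (wjac \<Omega> u x + transpose (wjac \<Omega> u x))"

definition lame_mu :: "real \<Rightarrow> real \<Rightarrow> real" where
  "lame_mu E \<nu> = E / (2 * (1 + \<nu>))"

definition lame_lambda :: "nat \<Rightarrow> real \<Rightarrow> real \<Rightarrow> real" where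
  "lame_lambda d E \<nu> =
     (if d = 2 then E * \<nu> / ((1 + \<nu>) * (1 - \<nu>)) else E * \<nu> / ((1 + \<nu>) * (1 - 2 * \<nu>)))"

definition stiffness :: "real \<Rightarrow> real \<Rightarrow> real^'d^'d \<Rightarrow> real^'d^'d" where
  "stiffness E \<nu> A =
     (lame_lambda CARD('d) E \<nu> * trace A) *\<^sub>R mat 1 + (2 * lame_mu E \<nu>) *\<^sub>R A"

text \<open>The interpolations are \<open>E(\<phi>) = interp Emin \<phi> E\<^sup>0\<close> and \<open>f(\<phi>) = interp fmin \<phi> f\<^sup>0\<close>, with exponent \<open>p = 3\<close>.\<close>

definition interp :: "real \<Rightarrow> real \<Rightarrow> real" where
  "interp m r = m + (1 - m) * r ^ 3"

definition double_well :: "real \<Rightarrow> real" where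
  "double_well r = 1/4 * r\<^sup>2 * (1 - r)\<^sup>2"

definition stress ::
  "(real^'d) set \<Rightarrow> real \<Rightarrow> real \<Rightarrow> real \<Rightarrow> (real^'d \<Rightarrow> real) \<Rightarrow> (real^'d \<Rightarrow> real^'d) \<Rightarrow> real^'d \<Rightarrow> real^'d^'d" where
  "stress \<Omega> Emin E \<nu> \<phi> u x = interp Emin (\<phi> x) *\<^sub>R stiffness E \<nu> (strain \<Omega> u x)"

definition dirichlet_space :: "(real^'d) set \<Rightarrow> (real^'d) set \<Rightarrow> (real^'d \<Rightarrow> real^'d) set" where
  "dirichlet_space \<Omega> \<Gamma>D =
     {v. (\<forall>i. (\<lambda>x. v x $ i) \<in> H1 \<Omega> \<and> (\<exists>w. has_trace \<Omega> (\<lambda>x. v x $ i) w)) \<and>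
         (AE x in surface \<Gamma>D. btrace_vec \<Omega> v x = 0)}"

text \<open>The last clause prescribes the traction on all of \<open>\<partial>\<Omega> - \<Gamma>D\<close> at once: \<open>s\<close> on \<open>\<Gamma>T\<close>, zero on the rest.\<close>

definition elasticity_solution ::
  "(real^'d) set \<Rightarrow> (real^'d) set \<Rightarrow> (real^'d) set \<Rightarrow> real \<Rightarrow> real \<Rightarrow> real \<Rightarrow> real
    \<Rightarrow> (real^'d \<Rightarrow> real^'d) \<Rightarrow> (real^'d \<Rightarrow> real^'d) \<Rightarrow> (real^'d \<Rightarrow> real) \<Rightarrow> (real^'d \<Rightarrow> real^'d) \<Rightarrow> bool" where
  "elasticity_solution \<Omega> \<Gamma>D \<Gamma>T Emin fmin E \<nu> f0 s \<phi> u \<longleftrightarrow>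
     u \<in> dirichlet_space \<Omega> \<Gamma>D \<and>
     (\<forall>i. weakly_divergent \<Omega> (\<lambda>x. stress \<Omega> Emin E \<nu> \<phi> u x $ i) \<and>
          (AE x in lebesgue_on \<Omega>.
             - wdiv \<Omega> (\<lambda>y. stress \<Omega> Emin E \<nu> \<phi> u y $ i) x = (interp fmin (\<phi> x) *\<^sub>R f0 x) $ i) \<and>
          has_normal_trace \<Omega> (frontier \<Omega> - \<Gamma>D) (\<lambda>x. stress \<Omega> Emin E \<nu> \<phi> u x $ i)
            (\<lambda>x. if x \<in> \<Gamma>T then s x $ i else 0))"

definition objective ::
  "(real^'d) set \<Rightarrow> (real^'d) set \<Rightarrow> real \<Rightarrow> real \<Rightarrow> real
    \<Rightarrow> (real^'d \<Rightarrow> real^'d) \<Rightarrow> (real^'d \<Rightarrow> real^'d) \<Rightarrow> (real^'d \<Rightarrow> real) \<Rightarrow> (real^'d \<Rightarrow> real^'d) \<Rightarrow> real" where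
  "objective \<Omega> \<Gamma>T fmin \<gamma> \<epsilon> f0 s \<phi> u =
     (\<integral>x. s x \<bullet> btrace_vec \<Omega> u x \<partial>surface \<Gamma>T)
     + (\<integral>x. (interp fmin (\<phi> x) *\<^sub>R f0 x) \<bullet> u x \<partial>lebesgue_on \<Omega>)
     + \<gamma> * (\<integral>x. \<epsilon> / 2 * (norm (wgrad \<Omega> \<phi> x))\<^sup>2 + 1 / \<epsilon> * double_well (\<phi> x) \<partial>lebesgue_on \<Omega>)"


section \<open>Time derivative of the order parameter\<close>

text \<open>\<open>\<psi>\<close> is the derivative at \<open>t\<close> of \<open>\<phi>\<close> as a map from time into \<open>H\<^sup>1(\<Omega>)\<close>, and \<open>\<phi>\<close> is Lipschitz at \<open>t\<close> as a
  map into \<open>L\<^sup>\<infinity>(\<Omega>)\<close>.\<close>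

definition has_time_derivative ::
  "(real^'d) set \<Rightarrow> (real \<Rightarrow> real^'d \<Rightarrow> real) \<Rightarrow> (real^'d \<Rightarrow> real) \<Rightarrow> real \<Rightarrow> bool" where
  "has_time_derivative \<Omega> \<phi> \<psi> t \<longleftrightarrow>
     \<psi> \<in> H1 \<Omega> \<and>
     L2_tendsto (lebesgue_on \<Omega>) (\<lambda>h x. (\<phi> (t + h) x - \<phi> t x) / h) \<psi> (at 0) \<and>
     L2_tendsto (lebesgue_on \<Omega>)
       (\<lambda>h x. (1 / h) *\<^sub>R (wgrad \<Omega> (\<phi> (t + h)) x - wgrad \<Omega> (\<phi> t) x)) (wgrad \<Omega> \<psi>) (at 0) \<and>
     (\<exists>C. \<forall>\<^sub>F h in at 0. AE x in lebesgue_on \<Omega>. \<bar>\<phi> (t + h) x - \<phi> t x\<bar> \<le> C * \<bar>h\<bar>)"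

end

theory Submission
  imports Defs
begin

text \<open>For \<open>h \<noteq> 0\<close> put \<open>\<tau> = t + h\<close>. Test the elasticity problem at time \<open>t\<close> with \<open>u(\<tau>)\<close> and at time \<open>\<tau>\<close>
  with \<open>u(t)\<close>. By the symmetry of \<open>E\<^sup>0\<close> the increment of the compliance becomes
  \<open>\<integral> (f(\<phi>(\<tau>)) - f(\<phi>(t))) \<bullet> (u(\<tau>) + u(t)) - \<integral> (E(\<phi>(\<tau>)) - E(\<phi>(t))) \<epsilon>(u(\<tau>)) : \<epsilon>(u(t))\<close>,
  so \<open>u\<close> need not be differentiated in time. Coercivity turns the continuity of \<open>u\<close> in \<open>L\<^sup>2\<close> into that
  of \<open>\<epsilon>(u)\<close>, and the difference quotient converges. The flow equation multiplied by \<open>\<psi> = \<partial>\<phi>/\<partial>t\<close>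
  identifies the limit: the term with \<open>\<lambda>\<close> drops out because the volume is constant, the one with \<open>\<eta>\<close>
  because \<open>\<psi> = 0\<close> almost everywhere on \<open>{\<phi> = 0} \<union> {\<phi> = 1}\<close>. Since only \<open>u(t)\<close> and \<open>u(\<tau>)\<close> serve as test
  fields, neither the linearity nor the uniqueness of traces and weak gradients is needed.\<close>

section \<open>Square-integrable functions\<close>

text \<open>The obstacle is \<open>E'(\<phi>) \<epsilon>(u) : \<epsilon>(u)\<close>. With
  \<open>u\<close> only in \<open>H1\<close> this product is merely integrable, and so is the
  Laplacian of \<phi>; neither can in general be paired with a square-integrable \<psi>. The pairing
  is saved by the Lipschitz bound of \<phi> at \<open>t\<close> with values in the bounded
  functions: \<psi> inherits the bound, and difference quotients of smooth functions of \<phi> are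
  uniformly bounded and converge in the mean square, which is enough to integrate them against any
  fixed integrable weight. The same bound makes \<psi> admissible in Green's formula for the
  Laplacian. The surface load is never estimated. It enters only through identities in which it
  cancels or is eliminated by the weak form, so no continuity of traces in time is involved. The
  term with \<eta> is cancelled pointwise, before any integration.\<close>

lemma square_integrable_measurable [measurable_dest]:
  "square_integrable M f \<Longrightarrow> f \<in> borel_measurable M"
  by (simp add: square_integrable_def)

lemma square_integrable_integrable:
  "square_integrable M f \<Longrightarrow> integrable M (\<lambda>x. (norm (f x))\<^sup>2)"
  by (simp add: square_integrable_def)

lemma square_integrable_bound:
  fixes f :: "'a \<Rightarrow> 'b::euclidean_space" and g :: "'a \<Rightarrow> 'c::euclidean_space"
  assumes g: "square_integrable M g" and f: "f \<in> borel_measurable M"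
    and le: "AE x in M. norm (f x) \<le> c * norm (g x)"
  shows "square_integrable M f"
proof -
  have "integrable M (\<lambda>x. (norm (f x))\<^sup>2)"
  proof (rule Bochner_Integration.integrable_bound)
    show "integrable M (\<lambda>x. c\<^sup>2 * (norm (g x))\<^sup>2)"
      using square_integrable_integrable[OF g] by simp
    show "(\<lambda>x. (norm (f x))\<^sup>2) \<in> borel_measurable M" using f by measurable
    show "AE x in M. norm ((norm (f x))\<^sup>2) \<le> norm (c\<^sup>2 * (norm (g x))\<^sup>2)"
      using le by eventually_elim (simp flip: power_mult_distrib add: power_mono)
  qed
  then show ?thesis using f by (simp add: square_integrable_def)
qed

lemma square_integrable_add:
  fixes f g :: "'a \<Rightarrow> 'b::euclidean_space"
  assumes f: "square_integrable M f" and g: "square_integrable M g"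
  shows "square_integrable M (\<lambda>x. f x + g x)"
proof -
  have "integrable M (\<lambda>x. (norm (f x + g x))\<^sup>2)"
  proof (rule Bochner_Integration.integrable_bound)
    show "integrable M (\<lambda>x. 2 * (norm (f x))\<^sup>2 + 2 * (norm (g x))\<^sup>2)"
      using square_integrable_integrable[OF f] square_integrable_integrable[OF g] by simp
    show "(\<lambda>x. (norm (f x + g x))\<^sup>2) \<in> borel_measurable M" using f g by measurable
    have "norm ((norm (f x + g x))\<^sup>2) \<le> norm (2 * (norm (f x))\<^sup>2 + 2 * (norm (g x))\<^sup>2)" for x
    proof -
      have "(norm (f x + g x))\<^sup>2 \<le> (norm (f x) + norm (g x))\<^sup>2"
        by (intro power_mono norm_triangle_ineq) simp
      also have "\<dots> \<le> 2 * (norm (f x))\<^sup>2 + 2 * (norm (g x))\<^sup>2"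
        using sum_squares_bound[of "norm (f x)" "norm (g x)"] by (simp add: power2_sum)
      finally show ?thesis by simp
    qed
    then show "AE x in M. norm ((norm (f x + g x))\<^sup>2) \<le> norm (2 * (norm (f x))\<^sup>2 + 2 * (norm (g x))\<^sup>2)"
      by simp
  qed
  moreover have "(\<lambda>x. f x + g x) \<in> borel_measurable M" using f g by measurable
  ultimately show ?thesis by (simp add: square_integrable_def)
qed

lemma square_integrable_bounded_linear:
  fixes f :: "'a \<Rightarrow> 'b::euclidean_space" and T :: "'b \<Rightarrow> 'c::euclidean_space"
  assumes T: "bounded_linear T" and f: "square_integrable M f"
  shows "square_integrable M (\<lambda>x. T (f x))"
proof -
  obtain K where K: "\<And>x. norm (T x) \<le> norm x * K"
    using bounded_linear.bounded[OF T] by blast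
  have "T \<in> borel_measurable borel"
    by (rule borel_measurable_continuous_onI[OF linear_continuous_on[OF T]])
  then have "(\<lambda>x. T (f x)) \<in> borel_measurable M"
    using square_integrable_measurable[OF f] by (rule measurable_compose_rev)
  then show ?thesis
    by (rule square_integrable_bound[where c = K, OF f]) (use K in \<open>simp add: mult.commute\<close>)
qed

lemma square_integrable_diff:
  fixes f g :: "'a \<Rightarrow> 'b::euclidean_space"
  assumes "square_integrable M f" and "square_integrable M g"
  shows "square_integrable M (\<lambda>x. f x - g x)"
  using square_integrable_add[OF assms(1)
      square_integrable_bounded_linear[OF bounded_linear_minus[OF bounded_linear_ident] assms(2)]]
  by simp

lemma (in finite_measure) square_integrable_bounded:
  fixes f :: "'a \<Rightarrow> 'b::euclidean_space"
  assumes "f \<in> borel_measurable M" "AE x in M. norm (f x) \<le> c"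
  shows "square_integrable M f"
  by (rule square_integrable_bound[of M "\<lambda>_. 1::real" f c])
    (use assms in \<open>simp_all add: square_integrable_def\<close>)

lemma (in finite_measure) square_integrable_imp_integrable:
  fixes f :: "'a \<Rightarrow> 'b::euclidean_space"
  assumes f: "square_integrable M f"
  shows "integrable M f"
proof (rule Bochner_Integration.integrable_bound)
  show "integrable M (\<lambda>x. 1 + (norm (f x))\<^sup>2)"
    using square_integrable_integrable[OF f] by simp
  show "f \<in> borel_measurable M" using f by measurable
  have "norm (f x) \<le> norm (1 + (norm (f x))\<^sup>2)" for x
    using sum_squares_bound[of 1 "norm (f x)"] norm_ge_zero[of "f x"] by (simp del: norm_ge_zero)
  then show "AE x in M. norm (f x) \<le> norm (1 + (norm (f x))\<^sup>2)" by simp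
qed

lemma integrable_norm_mult:
  fixes f :: "'a \<Rightarrow> 'b::euclidean_space" and g :: "'a \<Rightarrow> 'c::euclidean_space"
  assumes f: "square_integrable M f" and g: "square_integrable M g"
  shows "integrable M (\<lambda>x. norm (f x) * norm (g x))"
proof (rule Bochner_Integration.integrable_bound)
  show "integrable M (\<lambda>x. (norm (f x))\<^sup>2 + (norm (g x))\<^sup>2)"
    using square_integrable_integrable[OF f] square_integrable_integrable[OF g] by simp
  show "(\<lambda>x. norm (f x) * norm (g x)) \<in> borel_measurable M" using f g by measurable
  have "norm (norm (f x) * norm (g x)) \<le> norm ((norm (f x))\<^sup>2 + (norm (g x))\<^sup>2)" for x
  proof -
    have "norm (f x) * norm (g x) \<le> 2 * norm (f x) * norm (g x)" by simp
    also have "\<dots> \<le> (norm (f x))\<^sup>2 + (norm (g x))\<^sup>2" by (rule sum_squares_bound)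
    finally show ?thesis by simp
  qed
  then show "AE x in M. norm (norm (f x) * norm (g x)) \<le> norm ((norm (f x))\<^sup>2 + (norm (g x))\<^sup>2)"
    by simp
qed

lemma integrable_inner:
  fixes f g :: "'a \<Rightarrow> 'b::euclidean_space"
  assumes f: "square_integrable M f" and g: "square_integrable M g"
  shows "integrable M (\<lambda>x. f x \<bullet> g x)"
proof (rule Bochner_Integration.integrable_bound[OF integrable_norm_mult[OF f g]])
  show "(\<lambda>x. f x \<bullet> g x) \<in> borel_measurable M" using f g by measurable
  show "AE x in M. norm (f x \<bullet> g x) \<le> norm (norm (f x) * norm (g x))"
    by (simp add: Cauchy_Schwarz_ineq2)
qed

lemma integrable_bounded_mult:
  fixes q w :: "'a \<Rightarrow> real"
  assumes w: "integrable M w" and q: "q \<in> borel_measurable M" "AE x in M. \<bar>q x\<bar> \<le> c"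
  shows "integrable M (\<lambda>x. q x * w x)"
proof (rule Bochner_Integration.integrable_bound)
  show "integrable M (\<lambda>x. c * norm (w x))" using w by simp
  show "(\<lambda>x. q x * w x) \<in> borel_measurable M" using w q by measurable
  show "AE x in M. norm (q x * w x) \<le> norm (c * norm (w x))"
    using q(2)
  proof eventually_elim
    case (elim x)
    then have "\<bar>q x\<bar> * \<bar>w x\<bar> \<le> c * \<bar>w x\<bar>" by (rule mult_right_mono) simp
    also have "c * \<bar>w x\<bar> \<le> \<bar>c\<bar> * \<bar>w x\<bar>" by (rule mult_right_mono) auto
    finally show ?case by (simp add: abs_mult)
  qed
qed

text \<open>The Bochner integral returns 0 on functions that are not integrable, so this is the L2
  norm only in the presence of \<open>square_integrable\<close>. \<open>L2_tendsto\<close> is built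
  on the nonnegative integral and has no such default.\<close>

definition l2norm :: "'a measure \<Rightarrow> ('a \<Rightarrow> 'b::real_normed_vector) \<Rightarrow> real" where
  "l2norm M f = sqrt (\<integral>x. (norm (f x))\<^sup>2 \<partial>M)"

lemma l2norm_nonneg: "0 \<le> l2norm M f"
  by (simp add: l2norm_def)

lemma l2norm_power2: "(l2norm M f)\<^sup>2 = (\<integral>x. (norm (f x))\<^sup>2 \<partial>M)"
  by (simp add: l2norm_def)

text \<open>Cauchy-Schwarz from the pointwise bound on
  \<open>2 * (s * norm (f x)) * (r * norm (g x))\<close>, divided by \<open>2 * (r * s)\<close>.
  Taking \<open>r\<close> and \<open>s\<close> to be the norms enlarged by \<delta> permits the
  division even if a norm is zero; \<delta> tends to 0 at the end.\<close>

lemma integral_norm_mult_le: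
  fixes f :: "'a \<Rightarrow> 'b::euclidean_space" and g :: "'a \<Rightarrow> 'c::euclidean_space"
  assumes f: "square_integrable M f" and g: "square_integrable M g"
  shows "(\<integral>x. norm (f x) * norm (g x) \<partial>M) \<le> l2norm M f * l2norm M g"
proof -
  let ?I = "\<integral>x. norm (f x) * norm (g x) \<partial>M"
  have "?I \<le> (l2norm M f + \<delta>) * (l2norm M g + \<delta>)" if \<delta>: "\<delta> > 0" for \<delta>
  proof -
    define r s where "r = l2norm M f + \<delta>" and "s = l2norm M g + \<delta>"
    have pos: "r > 0" "s > 0"
      using \<delta> l2norm_nonneg[of M f] l2norm_nonneg[of M g] by (simp_all add: r_def s_def)
    have "2 * (r * s) * ?I = (\<integral>x. 2 * (r * s) * (norm (f x) * norm (g x)) \<partial>M)"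
      by simp
    also have "\<dots> \<le> (\<integral>x. s\<^sup>2 * (norm (f x))\<^sup>2 + r\<^sup>2 * (norm (g x))\<^sup>2 \<partial>M)"
    proof (rule integral_mono)
      show "integrable M (\<lambda>x. 2 * (r * s) * (norm (f x) * norm (g x)))"
        using integrable_norm_mult[OF f g] by simp
      show "integrable M (\<lambda>x. s\<^sup>2 * (norm (f x))\<^sup>2 + r\<^sup>2 * (norm (g x))\<^sup>2)"
        using square_integrable_integrable[OF f] square_integrable_integrable[OF g] by simp
      show "2 * (r * s) * (norm (f x) * norm (g x)) \<le> s\<^sup>2 * (norm (f x))\<^sup>2 + r\<^sup>2 * (norm (g x))\<^sup>2" for x
        using sum_squares_bound[of "s * norm (f x)" "r * norm (g x)"]
        by (simp add: power_mult_distrib algebra_simps)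
    qed
    also have "\<dots> = s\<^sup>2 * (l2norm M f)\<^sup>2 + r\<^sup>2 * (l2norm M g)\<^sup>2"
      using square_integrable_integrable[OF f] square_integrable_integrable[OF g]
      by (simp add: l2norm_power2)
    also have "\<dots> \<le> s\<^sup>2 * r\<^sup>2 + r\<^sup>2 * s\<^sup>2"
      using \<delta> l2norm_nonneg[of M f] l2norm_nonneg[of M g]
      by (intro add_mono mult_left_mono power_mono) (simp_all add: r_def s_def)
    also have "\<dots> = 2 * (r * s) * (r * s)" by (simp add: power2_eq_square)
    finally have "?I \<le> r * s"
      using pos by simp
    then show ?thesis by (simp add: r_def s_def)
  qed
  then have "\<forall>\<^sub>F \<delta> in at_right 0. ?I \<le> (l2norm M f + \<delta>) * (l2norm M g + \<delta>)"
    by (auto simp: eventually_at_filter)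
  moreover have "((\<lambda>\<delta>. (l2norm M f + \<delta>) * (l2norm M g + \<delta>))
      \<longlongrightarrow> (l2norm M f + 0) * (l2norm M g + 0)) (at_right 0)"
    by (intro tendsto_intros)
  ultimately have "?I \<le> (l2norm M f + 0) * (l2norm M g + 0)"
    by (intro tendsto_lowerbound[where F = "at_right (0::real)"]) auto
  then show ?thesis by simp
qed

lemma integral_inner_le:
  fixes f g :: "'a \<Rightarrow> 'b::euclidean_space"
  assumes f: "square_integrable M f" and g: "square_integrable M g"
  shows "\<bar>\<integral>x. f x \<bullet> g x \<partial>M\<bar> \<le> l2norm M f * l2norm M g"
proof -
  have "\<bar>\<integral>x. f x \<bullet> g x \<partial>M\<bar> \<le> (\<integral>x. \<bar>f x \<bullet> g x\<bar> \<partial>M)"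
    by (rule integral_abs_bound)
  also have "\<dots> \<le> (\<integral>x. norm (f x) * norm (g x) \<partial>M)"
    by (rule integral_mono)
      (simp_all add: integrable_inner[OF f g] integrable_norm_mult[OF f g] Cauchy_Schwarz_ineq2)
  also note integral_norm_mult_le[OF f g]
  finally show ?thesis .
qed

section \<open>Convergence in the mean square\<close>

lemma L2_tendsto_l2norm:
  fixes f :: "'i \<Rightarrow> 'a \<Rightarrow> 'b::euclidean_space"
  assumes f: "\<forall>\<^sub>F i in F. square_integrable M (f i)" and g: "square_integrable M g"
  shows "L2_tendsto M f g F \<longleftrightarrow> ((\<lambda>i. l2norm M (\<lambda>x. f i x - g x)) \<longlongrightarrow> 0) F"
proof -
  have eq: "\<forall>\<^sub>F i in F. (\<integral>\<^sup>+x. ennreal ((norm (f i x - g x))\<^sup>2) \<partial>M)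
      = ennreal ((l2norm M (\<lambda>x. f i x - g x))\<^sup>2)"
    using f
  proof eventually_elim
    case (elim i)
    show ?case
      unfolding l2norm_power2
      by (rule nn_integral_eq_integral[OF square_integrable_integrable[OF
              square_integrable_diff[OF elim g]]]) simp
  qed
  have "L2_tendsto M f g F \<longleftrightarrow> ((\<lambda>i. ennreal ((l2norm M (\<lambda>x. f i x - g x))\<^sup>2)) \<longlongrightarrow> 0) F"
    unfolding L2_tendsto_def by (rule tendsto_cong[OF eq])
  also have "\<dots> \<longleftrightarrow> ((\<lambda>i. (l2norm M (\<lambda>x. f i x - g x))\<^sup>2) \<longlongrightarrow> 0) F"
    using tendsto_ennreal_iff[of "\<lambda>i. (l2norm M (\<lambda>x. f i x - g x))\<^sup>2" F 0] by simp
  also have "\<dots> \<longleftrightarrow> ((\<lambda>i. l2norm M (\<lambda>x. f i x - g x)) \<longlongrightarrow> 0) F"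
  proof
    assume "((\<lambda>i. (l2norm M (\<lambda>x. f i x - g x))\<^sup>2) \<longlongrightarrow> 0) F"
    from tendsto_real_sqrt[OF this] show "((\<lambda>i. l2norm M (\<lambda>x. f i x - g x)) \<longlongrightarrow> 0) F"
      by (simp add: l2norm_nonneg)
  qed (simp add: tendsto_null_power)
  finally show ?thesis .
qed

text \<open>The increment is split around the limits: each error is multiplied by the other error or
  by a fixed norm, so the estimate tends to 0 by convergence alone.\<close>

lemma tendsto_integral_inner:
  fixes f g :: "'i \<Rightarrow> 'a \<Rightarrow> 'b::euclidean_space"
  assumes f: "\<forall>\<^sub>F i in F. square_integrable M (f i)" "square_integrable M f'" "L2_tendsto M f f' F"
    and g: "\<forall>\<^sub>F i in F. square_integrable M (g i)" "square_integrable M g'" "L2_tendsto M g g' F"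
  shows "((\<lambda>i. \<integral>x. f i x \<bullet> g i x \<partial>M) \<longlongrightarrow> (\<integral>x. f' x \<bullet> g' x \<partial>M)) F"
proof -
  let ?a = "\<lambda>i. l2norm M (\<lambda>x. f i x - f' x)" and ?b = "\<lambda>i. l2norm M (\<lambda>x. g i x - g' x)"
  have lims: "(?a \<longlongrightarrow> 0) F" "(?b \<longlongrightarrow> 0) F"
    using f g by (simp_all add: L2_tendsto_l2norm)
  have "((\<lambda>i. ?a i * ?b i + ?a i * l2norm M g' + l2norm M f' * ?b i)
      \<longlongrightarrow> 0 * 0 + 0 * l2norm M g' + l2norm M f' * 0) F"
    by (intro tendsto_intros lims)
  then have lim: "((\<lambda>i. ?a i * ?b i + ?a i * l2norm M g' + l2norm M f' * ?b i) \<longlongrightarrow> 0) F"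
    by simp
  have "\<forall>\<^sub>F i in F. norm ((\<integral>x. f i x \<bullet> g i x \<partial>M) - (\<integral>x. f' x \<bullet> g' x \<partial>M))
      \<le> ?a i * ?b i + ?a i * l2norm M g' + l2norm M f' * ?b i"
    using f(1) g(1)
  proof eventually_elim
    case (elim i)
    note df = square_integrable_diff[OF elim(1) f(2)] and dg = square_integrable_diff[OF elim(2) g(2)]
    have "(\<integral>x. f i x \<bullet> g i x \<partial>M) - (\<integral>x. f' x \<bullet> g' x \<partial>M)
        = (\<integral>x. f i x \<bullet> g i x - f' x \<bullet> g' x \<partial>M)"
      using integrable_inner[OF elim] integrable_inner[OF f(2) g(2)] by simp
    also have "\<dots> = (\<integral>x. (f i x - f' x) \<bullet> (g i x - g' x) + (f i x - f' x) \<bullet> g' x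
        + f' x \<bullet> (g i x - g' x) \<partial>M)"
      by (rule Bochner_Integration.integral_cong) (simp_all add: inner_diff)
    also have "\<dots> = (\<integral>x. (f i x - f' x) \<bullet> (g i x - g' x) \<partial>M) + (\<integral>x. (f i x - f' x) \<bullet> g' x \<partial>M)
        + (\<integral>x. f' x \<bullet> (g i x - g' x) \<partial>M)"
      using integrable_inner[OF df dg] integrable_inner[OF df g(2)] integrable_inner[OF f(2) dg] by simp
    finally show ?case
      using integral_inner_le[OF df dg] integral_inner_le[OF df g(2)] integral_inner_le[OF f(2) dg]
      by simp
  qed
  from Lim_null_comparison[OF this lim] show ?thesis
    by (simp add: LIM_zero_iff)
qed

lemma L2_tendsto_const: "L2_tendsto M (\<lambda>_. f) f F"
  by (simp add: L2_tendsto_def)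

lemma L2_tendsto_filter_mono: "L2_tendsto M f g F \<Longrightarrow> F' \<le> F \<Longrightarrow> L2_tendsto M f g F'"
  unfolding L2_tendsto_def by (rule tendsto_mono)

text \<open>The squared integral of \<open>e\<close> lies below errors that tend to 0. This is how a
  bound or a sign shared by all \<open>f i\<close> passes to a mean-square limit without extracting
  an almost everywhere convergent subsequence.\<close>

lemma L2_tendsto_AE_eq_0:
  fixes e :: "'a \<Rightarrow> real"
  assumes lim: "L2_tendsto M f g F" and F: "F \<noteq> bot" and e: "e \<in> borel_measurable M" "\<And>x. e x \<ge> 0"
    and le: "\<forall>\<^sub>F i in F. AE x in M. e x \<le> norm (f i x - g x)"
  shows "AE x in M. e x = 0"
proof -
  have "(\<integral>\<^sup>+x. ennreal ((e x)\<^sup>2) \<partial>M) \<le> 0"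
  proof (rule tendsto_lowerbound[OF lim[unfolded L2_tendsto_def] _ F])
    show "\<forall>\<^sub>F i in F. (\<integral>\<^sup>+x. ennreal ((e x)\<^sup>2) \<partial>M) \<le> (\<integral>\<^sup>+x. ennreal ((norm (f i x - g x))\<^sup>2) \<partial>M)"
      using le
    proof eventually_elim
      case (elim i)
      show ?case
        by (rule nn_integral_mono_AE) (use elim e in \<open>auto elim!: eventually_mono intro!: ennreal_leI power_mono\<close>)
    qed
  qed
  moreover have "(\<lambda>x. ennreal ((e x)\<^sup>2)) \<in> borel_measurable M" using e by measurable
  ultimately have "AE x in M. ennreal ((e x)\<^sup>2) = 0"
    by (simp add: nn_integral_0_iff_AE)
  then show ?thesis by eventually_elim simp
qed

text \<open>Bounded functions converging in the mean square converge weakly-* against \<open>L\<^sup>1\<close>: cut \<open>\<bar>w\<bar>\<close> off at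
  height \<open>N\<close>; the excess is small in \<open>L\<^sup>1\<close>.\<close>

lemma (in finite_measure) tendsto_integral_bounded_mult:
  fixes q :: "'i \<Rightarrow> 'a \<Rightarrow> real"
  assumes q: "\<forall>\<^sub>F i in F. q i \<in> borel_measurable M \<and> (AE x in M. \<bar>q i x\<bar> \<le> C)"
    and q': "q' \<in> borel_measurable M" "AE x in M. \<bar>q' x\<bar> \<le> C"
    and lim: "L2_tendsto M q q' F" and w: "integrable M w"
  shows "((\<lambda>i. \<integral>x. q i x * w x \<partial>M) \<longlongrightarrow> (\<integral>x. q' x * w x \<partial>M)) F"
proof -
  have sq': "square_integrable M q'"
    using square_integrable_bounded[OF q'(1)] q'(2) by simp
  have sq: "\<forall>\<^sub>F i in F. square_integrable M (q i)"
    using q by eventually_elim (auto intro!: square_integrable_bounded[where c = C])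
  have lim0: "((\<lambda>i. l2norm M (\<lambda>x. q i x - q' x)) \<longlongrightarrow> 0) F"
    using lim sq sq' by (simp add: L2_tendsto_l2norm)
  let ?t = "\<lambda>N::nat. \<integral>x. max 0 (\<bar>w x\<bar> - real N) \<partial>M"
  have [measurable]: "w \<in> borel_measurable M" using w by measurable
  have int_t: "integrable M (\<lambda>x. max 0 (\<bar>w x\<bar> - real N))" for N
  proof (rule Bochner_Integration.integrable_bound[OF w])
    show "AE x in M. norm (max 0 (\<bar>w x\<bar> - real N)) \<le> norm (w x)"
      by (simp add: max_def)
  qed measurable
  have "?t \<longlonglongrightarrow> (\<integral>x. 0 \<partial>M)"
  proof (rule integral_dominated_convergence[where w = "\<lambda>x. \<bar>w x\<bar>"])
    show "AE x in M. (\<lambda>N. max 0 (\<bar>w x\<bar> - real N)) \<longlonglongrightarrow> 0"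
    proof (rule AE_I2)
      fix x
      have "\<forall>\<^sub>F N in sequentially. max 0 (\<bar>w x\<bar> - real N) = 0"
        using eventually_ge_at_top[of "nat \<lceil>\<bar>w x\<bar>\<rceil>"] by eventually_elim linarith
      then show "(\<lambda>N. max 0 (\<bar>w x\<bar> - real N)) \<longlonglongrightarrow> 0" by (rule tendsto_eventually)
    qed
  next
    show "AE x in M. norm (max 0 (\<bar>w x\<bar> - real N)) \<le> \<bar>w x\<bar>" for N
      by (simp add: max_def)
  qed (use w in simp_all)
  then have lim_t: "?t \<longlonglongrightarrow> 0" by simp
  define m where "m = l2norm M (\<lambda>_. 1::real)"
  have one: "square_integrable M (\<lambda>_. 1::real)" by (simp add: square_integrable_def)
  \<comment> \<open>One estimate for every cutoff height. Up to height \<open>N\<close> the weight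
    is bounded and the L2 distance controls the error; above it only the bound \<open>2 * C\<close>
    on the difference is available, multiplied by the tail \<open>?t N\<close>.\<close>
  have est: "\<forall>\<^sub>F i in F. \<forall>N. \<bar>(\<integral>x. q i x * w x \<partial>M) - (\<integral>x. q' x * w x \<partial>M)\<bar>
      \<le> real N * (l2norm M (\<lambda>x. q i x - q' x) * m) + 2 * C * ?t N"
    using q sq
  proof eventually_elim
    case (elim i)
    note d = square_integrable_diff[OF elim(2) sq']
    have d1: "(\<integral>x. \<bar>q i x - q' x\<bar> \<partial>M) \<le> l2norm M (\<lambda>x. q i x - q' x) * m"
      using integral_norm_mult_le[OF d one] by (simp add: m_def)
    have [measurable]: "q i \<in> borel_measurable M" "q' \<in> borel_measurable M"
      using elim q' by auto
    have b: "AE x in M. \<bar>q i x - q' x\<bar> \<le> 2 * C"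
      using conjunct2[OF elim(1)] q'(2) by eventually_elim linarith
    show ?case
    proof
      fix N
      have "\<bar>(\<integral>x. q i x * w x \<partial>M) - (\<integral>x. q' x * w x \<partial>M)\<bar> = \<bar>\<integral>x. (q i x - q' x) * w x \<partial>M\<bar>"
        using integrable_bounded_mult[OF w, of "q i" C] integrable_bounded_mult[OF w q'] elim(1)
        by (simp add: left_diff_distrib)
      also have "\<dots> \<le> (\<integral>x. \<bar>(q i x - q' x) * w x\<bar> \<partial>M)"
        by (rule integral_abs_bound)
      also have "\<dots> \<le> (\<integral>x. real N * \<bar>q i x - q' x\<bar> + 2 * C * max 0 (\<bar>w x\<bar> - real N) \<partial>M)"
      proof (rule integral_mono_AE)
        show "integrable M (\<lambda>x. \<bar>(q i x - q' x) * w x\<bar>)"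
          using integrable_bounded_mult[OF w _ b] by simp
        show "integrable M (\<lambda>x. real N * \<bar>q i x - q' x\<bar> + 2 * C * max 0 (\<bar>w x\<bar> - real N))"
          using square_integrable_imp_integrable[OF d] int_t[of N] by simp
        show "AE x in M. \<bar>(q i x - q' x) * w x\<bar>
            \<le> real N * \<bar>q i x - q' x\<bar> + 2 * C * max 0 (\<bar>w x\<bar> - real N)"
          using b
        proof eventually_elim
          case (elim x)
          have "\<bar>w x\<bar> \<le> real N + max 0 (\<bar>w x\<bar> - real N)" by simp
          then have "\<bar>q i x - q' x\<bar> * \<bar>w x\<bar> \<le> \<bar>q i x - q' x\<bar> * (real N + max 0 (\<bar>w x\<bar> - real N))"
            by (rule mult_left_mono) simp
          also have "\<dots> \<le> real N * \<bar>q i x - q' x\<bar> + 2 * C * max 0 (\<bar>w x\<bar> - real N)"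
            using mult_right_mono[OF elim, of "max 0 (\<bar>w x\<bar> - real N)"] by (simp add: algebra_simps)
          finally show ?case by (simp add: abs_mult)
        qed
      qed
      also have "\<dots> = real N * (\<integral>x. \<bar>q i x - q' x\<bar> \<partial>M) + 2 * C * ?t N"
        using square_integrable_imp_integrable[OF d] int_t[of N] by simp
      also have "\<dots> \<le> real N * (l2norm M (\<lambda>x. q i x - q' x) * m) + 2 * C * ?t N"
        using mult_left_mono[OF d1, of "real N"] by simp
      finally show "\<bar>(\<integral>x. q i x * w x \<partial>M) - (\<integral>x. q' x * w x \<partial>M)\<bar>
          \<le> real N * (l2norm M (\<lambda>x. q i x - q' x) * m) + 2 * C * ?t N" .
    qed
  qed
  show ?thesis
  proof (rule tendstoI)
    fix e :: real assume e: "e > 0"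
    \<comment> \<open>The cutoff is fixed first, by the tail alone; only then is \<open>i\<close>
      restricted, depending on \<open>N\<close>.\<close>
    have "(\<lambda>N. 2 * C * ?t N) \<longlonglongrightarrow> 2 * C * 0" by (intro tendsto_intros lim_t)
    then have "\<forall>\<^sub>F N in sequentially. 2 * C * ?t N < e / 2"
      using e by (intro order_tendstoD) auto
    then obtain N where N: "2 * C * ?t N < e / 2"
      by (auto simp: eventually_sequentially)
    have "((\<lambda>i. real N * (l2norm M (\<lambda>x. q i x - q' x) * m)) \<longlongrightarrow> real N * (0 * m)) F"
      by (intro tendsto_intros lim0)
    then have "\<forall>\<^sub>F i in F. real N * (l2norm M (\<lambda>x. q i x - q' x) * m) < e / 2"
      using e by (intro order_tendstoD) auto
    then show "\<forall>\<^sub>F i in F. dist (\<integral>x. q i x * w x \<partial>M) (\<integral>x. q' x * w x \<partial>M) < e"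
      using est
    proof eventually_elim
      case (elim i)
      from elim(2)[rule_format, of N] elim(1) N show ?case by (simp add: dist_real_def)
    qed
  qed
qed

text \<open>Replacing \<open>a i\<close> by its limit costs at most \<open>C\<close> times the L2
  error of \<open>a i\<close> times the norm of \<open>b\<close>; afterwards the weight
  \<open>a' x \<bullet> b x\<close> is fixed and integrable.\<close>

lemma (in finite_measure) tendsto_integral_bounded_mult_inner:
  fixes q :: "'i \<Rightarrow> 'a \<Rightarrow> real" and a :: "'i \<Rightarrow> 'a \<Rightarrow> 'b::euclidean_space"
  assumes C: "0 \<le> C" and q: "\<forall>\<^sub>F i in F. q i \<in> borel_measurable M \<and> (AE x in M. \<bar>q i x\<bar> \<le> C)"
    and q': "q' \<in> borel_measurable M" "AE x in M. \<bar>q' x\<bar> \<le> C"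
    and lim: "L2_tendsto M q q' F"
    and a: "\<forall>\<^sub>F i in F. square_integrable M (a i)" "square_integrable M a'" "L2_tendsto M a a' F"
    and b: "square_integrable M b"
  shows "((\<lambda>i. \<integral>x. q i x * (a i x \<bullet> b x) \<partial>M) \<longlongrightarrow> (\<integral>x. q' x * (a' x \<bullet> b x) \<partial>M)) F"
proof -
  have 1: "((\<lambda>i. \<integral>x. q i x * (a' x \<bullet> b x) \<partial>M) \<longlongrightarrow> (\<integral>x. q' x * (a' x \<bullet> b x) \<partial>M)) F"
    by (rule tendsto_integral_bounded_mult[OF q q' lim integrable_inner[OF a(2) b]])
  have "((\<lambda>i. C * (l2norm M (\<lambda>x. a i x - a' x) * l2norm M b)) \<longlongrightarrow> C * (0 * l2norm M b)) F"
    using a by (intro tendsto_intros) (simp add: L2_tendsto_l2norm)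
  then have lim0: "((\<lambda>i. C * (l2norm M (\<lambda>x. a i x - a' x) * l2norm M b)) \<longlongrightarrow> 0) F" by simp
  have "\<forall>\<^sub>F i in F. norm ((\<integral>x. q i x * (a i x \<bullet> b x) \<partial>M) - (\<integral>x. q i x * (a' x \<bullet> b x) \<partial>M))
      \<le> C * (l2norm M (\<lambda>x. a i x - a' x) * l2norm M b)"
    using q a(1)
  proof eventually_elim
    case (elim i)
    note d = square_integrable_diff[OF elim(2) a(2)]
    have qi: "q i \<in> borel_measurable M" "AE x in M. \<bar>q i x\<bar> \<le> C" using elim by auto
    note ints = integrable_bounded_mult[OF integrable_inner[OF elim(2) b] qi]
      integrable_bounded_mult[OF integrable_inner[OF a(2) b] qi]
      integrable_bounded_mult[OF integrable_inner[OF d b] qi]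
    have "norm ((\<integral>x. q i x * (a i x \<bullet> b x) \<partial>M) - (\<integral>x. q i x * (a' x \<bullet> b x) \<partial>M))
        = \<bar>\<integral>x. q i x * ((a i x - a' x) \<bullet> b x) \<partial>M\<bar>"
      using ints by (simp add: inner_diff_left right_diff_distrib)
    also have "\<dots> \<le> (\<integral>x. \<bar>q i x * ((a i x - a' x) \<bullet> b x)\<bar> \<partial>M)"
      by (rule integral_abs_bound)
    also have "\<dots> \<le> (\<integral>x. C * (norm (a i x - a' x) * norm (b x)) \<partial>M)"
    proof (rule integral_mono_AE)
      show "AE x in M. \<bar>q i x * ((a i x - a' x) \<bullet> b x)\<bar> \<le> C * (norm (a i x - a' x) * norm (b x))"
        using qi(2)
      proof eventually_elim
        case (elim x)
        then show ?case
          unfolding abs_mult using Cauchy_Schwarz_ineq2[of "a i x - a' x" "b x"]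
          by (intro mult_mono) auto
      qed
    qed (use ints integrable_norm_mult[OF d b] in auto)
    also have "\<dots> = C * (\<integral>x. norm (a i x - a' x) * norm (b x) \<partial>M)" by simp
    also have "\<dots> \<le> C * (l2norm M (\<lambda>x. a i x - a' x) * l2norm M b)"
      using C by (intro mult_left_mono integral_norm_mult_le[OF d b])
    finally show ?case .
  qed
  from tendsto_add[OF Lim_null_comparison[OF this lim0] 1] show ?thesis by simp
qed

text \<open>Young's inequality with the weight matched to an ellipticity constant \<open>c\<close>,
  so that the term with \<open>n\<close> takes up exactly half of \<open>c * n\<^sup>2\<close> and
  can be absorbed.\<close>

lemma weighted_AM_GM:
  fixes a c n :: real
  assumes "c > 0"
  shows "n * a \<le> c / 2 * n\<^sup>2 + a\<^sup>2 / (2 * c)"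
proof -
  have "c / 2 * n\<^sup>2 + a\<^sup>2 / (2 * c) - n * a = (c * n - a)\<^sup>2 / (2 * c)"
    using assms by (simp add: field_simps power2_eq_square)
  also have "\<dots> \<ge> 0" using assms by simp
  finally show ?thesis by simp
qed

section \<open>Differentiable paths of bounded functions\<close>

text \<open>Taylor's formula of second order with derivative \<open>g\<close>, demanded only on
  [0, 1], where the order parameter takes its values. Being an inequality, it is checked for
  polynomials by factoring out \<open>(b - a)\<^sup>2\<close>.\<close>

definition quadratic_remainder :: "(real \<Rightarrow> real) \<Rightarrow> (real \<Rightarrow> real) \<Rightarrow> real \<Rightarrow> bool" where
  "quadratic_remainder G g K \<longleftrightarrow> K \<ge> 0 \<and> G \<in> borel_measurable borel \<and> g \<in> borel_measurable borel \<and>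
     (\<forall>a\<in>{0..1}. \<bar>g a\<bar> \<le> K \<and> (\<forall>b\<in>{0..1}. \<bar>G b - G a - g a * (b - a)\<bar> \<le> K * (b - a)\<^sup>2))"

text \<open>The time-differentiation argument on an abstract finite measure space, apart from weak
  derivatives and traces. The derivative and the Lipschitz bound concern the single time
  \<open>t\<close>; measurability and range are known at all positive times.\<close>

locale bounded_path = finite_measure M for M :: "'a measure" +
  fixes \<phi> :: "real \<Rightarrow> 'a \<Rightarrow> real" and \<psi> :: "'a \<Rightarrow> real" and t C :: real
  assumes t_pos: "t > 0" and C_nonneg: "C \<ge> 0"
    and path_measurable: "\<And>\<tau>. \<tau> > 0 \<Longrightarrow> \<phi> \<tau> \<in> borel_measurable M"
    and path_range: "\<And>\<tau>. \<tau> > 0 \<Longrightarrow> AE x in M. \<phi> \<tau> x \<in> {0..1}"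
    and psi_measurable: "\<psi> \<in> borel_measurable M"
    and path_Lipschitz: "\<forall>\<^sub>F h in at 0. AE x in M. \<bar>\<phi> (t + h) x - \<phi> t x\<bar> \<le> C * \<bar>h\<bar>"
    and path_derivative: "L2_tendsto M (\<lambda>h x. (\<phi> (t + h) x - \<phi> t x) / h) \<psi> (at 0)"
begin

lemma eventually_pos: "\<forall>\<^sub>F h in at 0. t + h > 0 \<and> h \<noteq> 0"
  using eventually_at_ball[of "t" "0::real" UNIV] t_pos
  by (auto simp: eventually_at dist_real_def intro!: exI[of _ t])

text \<open>The amount by which the limit exceeds \<open>C\<close> is at most its distance to any
  number bounded by \<open>C\<close>, in particular to every difference quotient.\<close>

lemma psi_bounded: "AE x in M. \<bar>\<psi> x\<bar> \<le> C"
proof -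
  have excess: "max 0 (\<bar>p\<bar> - C) \<le> norm (d - p)" if "\<bar>d\<bar> \<le> C" for d p
    using that by (auto simp: max_def abs_if split: if_splits)
  have "AE x in M. max 0 (\<bar>\<psi> x\<bar> - C) = 0"
  proof (rule L2_tendsto_AE_eq_0[OF path_derivative])
    show "\<forall>\<^sub>F h in at 0. AE x in M. max 0 (\<bar>\<psi> x\<bar> - C) \<le> norm ((\<phi> (t + h) x - \<phi> t x) / h - \<psi> x)"
      using path_Lipschitz eventually_pos
    proof eventually_elim
      case (elim h)
      from elim(1) show ?case
      proof eventually_elim
        case (elim x)
        with \<open>t + h > 0 \<and> h \<noteq> 0\<close> have "\<bar>(\<phi> (t + h) x - \<phi> t x) / h\<bar> \<le> C"
          by (simp add: divide_le_eq)
        then show ?case by (rule excess)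
      qed
    qed
  qed (use psi_measurable in simp_all)
  then show ?thesis by eventually_elim (simp add: max_def split: if_splits)
qed

lemma square_integrable_psi: "square_integrable M \<psi>"
  by (rule square_integrable_bounded[OF psi_measurable]) (use psi_bounded in simp)

text \<open>Where the path touches an end of \<open>[0, 1]\<close>, its difference quotients from the left and from the
  right have opposite signs.\<close>

lemma psi_eq_0: "AE x in M. \<phi> t x \<in> {0, 1} \<longrightarrow> \<psi> x = 0"
proof -
  let ?d = "\<lambda>h x. (\<phi> (t + h) x - \<phi> t x) / h"
  have [measurable]: "\<phi> t \<in> borel_measurable M" "\<psi> \<in> borel_measurable M"
    using path_measurable[OF t_pos] psi_measurable by auto
  define pos neg where "pos = (\<lambda>x. if \<phi> t x \<in> {0, 1} then max 0 (\<psi> x) else 0)"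
    and "neg = (\<lambda>x. if \<phi> t x \<in> {0, 1} then max 0 (- \<psi> x) else 0)"
  have [measurable]: "pos \<in> borel_measurable M" "neg \<in> borel_measurable M"
    unfolding pos_def neg_def by measurable
  \<comment> \<open>\<open>h * ?d h x\<close> is the increment of the path, which can only go up
    from 0 and only go down from 1.\<close>
  have signs: "AE x in M. (\<phi> t x = 0 \<longrightarrow> 0 \<le> h * ?d h x) \<and> (\<phi> t x = 1 \<longrightarrow> h * ?d h x \<le> 0)"
    if "t + h > 0 \<and> h \<noteq> 0" for h
    using path_range[of "t + h"] that by auto
  \<comment> \<open>\<open>r\<close> is the sign of the possible increments at the end
    \<open>a\<close>, and \<sigma> selects the positive or the negative part of \<psi>; one argument
    thus covers all four cases.\<close>
  have half: "AE x in M. (if \<phi> t x = a then max 0 (\<sigma> * \<psi> x) else 0) = 0"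
    if a: "(a = 0 \<and> r = 1) \<or> (a = 1 \<and> r = - 1)" and \<sigma>: "\<sigma> \<in> {1, - 1}" for a r \<sigma> :: real
  proof -
    have excess: "max 0 (\<sigma> * p) \<le> norm (d - p)" if "\<sigma> * d \<le> 0" for d p
      using that \<sigma> by (auto simp: max_def abs_if)
    \<comment> \<open>The side is chosen so that \<open>h\<close> has the sign opposite to
      \<open>r * \<sigma>\<close>. Then \<sigma> times the quotient is nonpositive, and the positive
      part of \<sigma> times \<psi> is at most the error of the quotient.\<close>
    let ?F = "if r * \<sigma> < 0 then at_right (0::real) else at_left 0"
    show ?thesis
    proof (rule L2_tendsto_AE_eq_0[OF L2_tendsto_filter_mono[OF path_derivative, of ?F]])
      show "?F \<le> at 0" by (simp add: at_le)
      show "?F \<noteq> bot" by simp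
      have "\<forall>\<^sub>F h in ?F. h * (r * \<sigma>) < 0"
        using \<sigma> a by (auto simp: eventually_at_filter)
      moreover have "\<forall>\<^sub>F h in ?F. t + h > 0 \<and> h \<noteq> 0"
        by (rule filter_leD[OF _ eventually_pos]) (simp add: at_le)
      ultimately show "\<forall>\<^sub>F h in ?F. AE x in M.
          (if \<phi> t x = a then max 0 (\<sigma> * \<psi> x) else 0) \<le> norm (?d h x - \<psi> x)"
      proof eventually_elim
        case (elim h)
        from signs[OF elim(2)] show ?case
        proof eventually_elim
          case (elim x)
          show ?case
          proof (cases "\<phi> t x = a")
            case True
            with elim a have *: "0 \<le> r * (h * ?d h x)" by auto
            have "\<sigma> * ?d h x \<le> 0"
            proof (rule ccontr)
              assume "\<not> \<sigma> * ?d h x \<le> 0"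
              then have "0 < \<sigma> * ?d h x" by linarith
              with \<open>h * (r * \<sigma>) < 0\<close> have "(h * (r * \<sigma>)) * (\<sigma> * ?d h x) < 0"
                by (rule mult_neg_pos)
              moreover have "(h * (r * \<sigma>)) * (\<sigma> * ?d h x) = r * (h * ?d h x)"
                using \<sigma> by auto
              ultimately show False using * by linarith
            qed
            from excess[OF this] True show ?thesis by simp
          qed simp
        qed
      qed
    qed simp_all
  qed
  have "AE x in M. (if \<phi> t x = 0 then max 0 (1 * \<psi> x) else 0) = 0"
    "AE x in M. (if \<phi> t x = 0 then max 0 (- 1 * \<psi> x) else 0) = 0"
    "AE x in M. (if \<phi> t x = 1 then max 0 (1 * \<psi> x) else 0) = 0"
    "AE x in M. (if \<phi> t x = 1 then max 0 (- 1 * \<psi> x) else 0) = 0"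
    by ((rule half[where r = 1]; simp), (rule half[where r = 1]; simp),
        (rule half[where r = "- 1"]; simp), (rule half[where r = "- 1"]; simp))
  then show ?thesis
    by eventually_elim (auto simp: max_def split: if_splits)
qed

text \<open>A chain rule in the mean square, together with the uniform bounds required for testing
  against integrable weights. In \<open>2 * K * C\<close> one \<open>K\<close> comes from the
  derivative and one from the remainder.\<close>

lemma difference_quotient:
  assumes G: "quadratic_remainder G g K"
  defines "q \<equiv> \<lambda>h x. (G (\<phi> (t + h) x) - G (\<phi> t x)) / h"
  shows "\<forall>\<^sub>F h in at 0. q h \<in> borel_measurable M \<and> (AE x in M. \<bar>q h x\<bar> \<le> 2 * K * C)"
    and "(\<lambda>x. g (\<phi> t x) * \<psi> x) \<in> borel_measurable M"
    and "AE x in M. \<bar>g (\<phi> t x) * \<psi> x\<bar> \<le> 2 * K * C"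
    and "L2_tendsto M q (\<lambda>x. g (\<phi> t x) * \<psi> x) (at 0)"
proof -
  note range_t = path_range[OF t_pos]
  let ?d = "\<lambda>h x. (\<phi> (t + h) x - \<phi> t x) / h"
  have K: "K \<ge> 0" and [measurable]: "G \<in> borel_measurable borel" "g \<in> borel_measurable borel"
    and gK: "\<And>a. a \<in> {0..1} \<Longrightarrow> \<bar>g a\<bar> \<le> K"
    and rem: "\<And>a b. a \<in> {0..1} \<Longrightarrow> b \<in> {0..1} \<Longrightarrow> \<bar>G b - G a - g a * (b - a)\<bar> \<le> K * (b - a)\<^sup>2"
    using G by (auto simp: quadratic_remainder_def)
  have [measurable]: "\<phi> t \<in> borel_measurable M" "\<psi> \<in> borel_measurable M"
    using path_measurable[OF t_pos] psi_measurable by auto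
  show meas: "(\<lambda>x. g (\<phi> t x) * \<psi> x) \<in> borel_measurable M" by measurable
  show "AE x in M. \<bar>g (\<phi> t x) * \<psi> x\<bar> \<le> 2 * K * C"
    using range_t psi_bounded
  proof eventually_elim
    case (elim x)
    have "\<bar>g (\<phi> t x)\<bar> * \<bar>\<psi> x\<bar> \<le> K * C"
      using gK[OF elim(1)] elim(2) K by (intro mult_mono) auto
    \<comment> \<open>The limit satisfies the better bound \<open>K * C\<close>; it is relaxed so
      that limit and quotients share one constant.\<close>
    also have "\<dots> \<le> 2 * K * C" using K C_nonneg by simp
    finally show ?case by (simp add: abs_mult)
  qed
  have pointwise: "\<forall>\<^sub>F h in at 0. \<phi> (t + h) \<in> borel_measurable M \<and>
      (AE x in M. \<bar>q h x\<bar> \<le> 2 * K * C \<and> \<bar>q h x - g (\<phi> t x) * \<psi> x\<bar> \<le> K * \<bar>?d h x - \<psi> x\<bar> + K * C\<^sup>2 * \<bar>h\<bar>)"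
    using path_Lipschitz eventually_pos
  proof eventually_elim
    case (elim h)
    have h: "h \<noteq> 0" and th: "t + h > 0" using elim(2) by auto
    have "AE x in M. \<bar>q h x\<bar> \<le> 2 * K * C \<and>
        \<bar>q h x - g (\<phi> t x) * \<psi> x\<bar> \<le> K * \<bar>?d h x - \<psi> x\<bar> + K * C\<^sup>2 * \<bar>h\<bar>"
      using elim(1) range_t path_range[OF th]
    proof eventually_elim
      case (elim x)
      let ?a = "\<phi> t x" and ?b = "\<phi> (t + h) x"
      have R: "\<bar>G ?b - G ?a - g ?a * (?b - ?a)\<bar> \<le> K * (?b - ?a)\<^sup>2" by (rule rem) fact+
      have g: "\<bar>g ?a\<bar> \<le> K" by (rule gK) fact
      \<comment> \<open>For the uniform bound one factor of the squared increment is spent on the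
        estimate by 1, valid since both values lie in [0, 1]. For convergence the full square is
        kept in \<open>sq2\<close>, so that the remainder divided by \<open>h\<close> is still of
        order \<open>h\<close>.\<close>
      have "\<bar>?b - ?a\<bar> * \<bar>?b - ?a\<bar> \<le> 1 * \<bar>?b - ?a\<bar>"
        by (rule mult_right_mono) (use elim in auto)
      then have sq1: "(?b - ?a)\<^sup>2 \<le> \<bar>?b - ?a\<bar>" by (simp add: power2_eq_square)
      have sq2: "(?b - ?a)\<^sup>2 \<le> (C * \<bar>h\<bar>)\<^sup>2"
        using power_mono[OF elim(1), of 2] by simp
      have "\<bar>G ?b - G ?a\<bar> \<le> K * (?b - ?a)\<^sup>2 + \<bar>g ?a\<bar> * \<bar>?b - ?a\<bar>"
        using R by (simp add: abs_mult[symmetric])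
      also have "\<dots> \<le> K * \<bar>?b - ?a\<bar> + K * \<bar>?b - ?a\<bar>"
        by (intro add_mono mult_left_mono mult_right_mono sq1 K g) simp
      also have "\<dots> \<le> K * (C * \<bar>h\<bar>) + K * (C * \<bar>h\<bar>)"
        by (intro add_mono mult_left_mono K elim)
      finally have 1: "\<bar>q h x\<bar> \<le> 2 * K * C"
        using h by (simp add: q_def divide_le_eq ac_simps)
      have "q h x - g ?a * \<psi> x = g ?a * (?d h x - \<psi> x) + (G ?b - G ?a - g ?a * (?b - ?a)) / h"
        using h by (simp add: q_def field_simps)
      then have "\<bar>q h x - g ?a * \<psi> x\<bar> \<le> \<bar>g ?a\<bar> * \<bar>?d h x - \<psi> x\<bar> + \<bar>G ?b - G ?a - g ?a * (?b - ?a)\<bar> / \<bar>h\<bar>"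
        using abs_triangle_ineq[of "g ?a * (?d h x - \<psi> x)" "(G ?b - G ?a - g ?a * (?b - ?a)) / h"]
        by (simp add: abs_mult)
      also have "\<dots> \<le> K * \<bar>?d h x - \<psi> x\<bar> + K * C\<^sup>2 * \<bar>h\<bar>"
      proof (rule add_mono)
        show "\<bar>g ?a\<bar> * \<bar>?d h x - \<psi> x\<bar> \<le> K * \<bar>?d h x - \<psi> x\<bar>" using g by (rule mult_right_mono) simp
        have "\<bar>G ?b - G ?a - g ?a * (?b - ?a)\<bar> \<le> K * (C * \<bar>h\<bar>)\<^sup>2"
          using R mult_left_mono[OF sq2 K] by linarith
        also have "\<dots> = K * C\<^sup>2 * \<bar>h\<bar> * \<bar>h\<bar>" by (simp add: power2_eq_square)
        finally show "\<bar>G ?b - G ?a - g ?a * (?b - ?a)\<bar> / \<bar>h\<bar> \<le> K * C\<^sup>2 * \<bar>h\<bar>"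
          using h by (simp add: divide_le_eq)
      qed
      finally show ?case using 1 by blast
    qed
    with path_measurable[OF th] show ?case by blast
  qed
  show bounded: "\<forall>\<^sub>F h in at 0. q h \<in> borel_measurable M \<and> (AE x in M. \<bar>q h x\<bar> \<le> 2 * K * C)"
    using pointwise
  proof eventually_elim
    case (elim h)
    then have [measurable]: "\<phi> (t + h) \<in> borel_measurable M" by simp
    have "q h \<in> borel_measurable M" unfolding q_def by measurable
    with elim show ?case by auto
  qed
  let ?X = "\<lambda>h. \<integral>\<^sup>+x. ennreal ((norm (?d h x - \<psi> x))\<^sup>2) \<partial>M"
  \<comment> \<open>The error splits into a multiple of the error of the original quotients and a
    constant of order \<open>h\<^sup>2\<close>, whose integral is finite because the measure
    is.\<close>
  have upper: "\<forall>\<^sub>F h in at 0. (\<integral>\<^sup>+x. ennreal ((norm (q h x - g (\<phi> t x) * \<psi> x))\<^sup>2) \<partial>M)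
      \<le> ennreal (2 * K\<^sup>2) * ?X h + ennreal (2 * (K * C\<^sup>2 * \<bar>h\<bar>)\<^sup>2 * measure M (space M))"
    using pointwise
  proof eventually_elim
    case (elim h)
    then have [measurable]: "\<phi> (t + h) \<in> borel_measurable M" by simp
    have "(\<integral>\<^sup>+x. ennreal ((norm (q h x - g (\<phi> t x) * \<psi> x))\<^sup>2) \<partial>M)
        \<le> (\<integral>\<^sup>+x. ennreal (2 * K\<^sup>2) * ennreal ((norm (?d h x - \<psi> x))\<^sup>2) + ennreal (2 * (K * C\<^sup>2 * \<bar>h\<bar>)\<^sup>2) \<partial>M)"
    proof (rule nn_integral_mono_AE)
      show "AE x in M. ennreal ((norm (q h x - g (\<phi> t x) * \<psi> x))\<^sup>2)
          \<le> ennreal (2 * K\<^sup>2) * ennreal ((norm (?d h x - \<psi> x))\<^sup>2) + ennreal (2 * (K * C\<^sup>2 * \<bar>h\<bar>)\<^sup>2)"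
        using conjunct2[OF elim]
      proof eventually_elim
        case (elim x)
        let ?u = "K * \<bar>?d h x - \<psi> x\<bar>" and ?v = "K * C\<^sup>2 * \<bar>h\<bar>"
        have "(norm (q h x - g (\<phi> t x) * \<psi> x))\<^sup>2 \<le> (?u + ?v)\<^sup>2"
          unfolding real_norm_def using elim by (intro power_mono) auto
        also have "\<dots> \<le> 2 * ?u\<^sup>2 + 2 * ?v\<^sup>2"
          using sum_squares_bound[of ?u ?v] by (simp add: power2_sum)
        also have "\<dots> = 2 * K\<^sup>2 * (norm (?d h x - \<psi> x))\<^sup>2 + 2 * ?v\<^sup>2"
          by (simp add: power_mult_distrib)
        finally show ?case by (simp add: ennreal_leI flip: ennreal_mult ennreal_plus)
      qed
    qed
    also have "\<dots> = ennreal (2 * K\<^sup>2) * ?X h + ennreal (2 * (K * C\<^sup>2 * \<bar>h\<bar>)\<^sup>2) * emeasure M (space M)"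
      by (subst nn_integral_add) (simp_all add: nn_integral_cmult)
    also have "ennreal (2 * (K * C\<^sup>2 * \<bar>h\<bar>)\<^sup>2) * emeasure M (space M)
        = ennreal (2 * (K * C\<^sup>2 * \<bar>h\<bar>)\<^sup>2 * measure M (space M))"
      by (simp add: emeasure_eq_measure ennreal_mult)
    finally show ?case .
  qed
  have "((\<lambda>h. ennreal (2 * K\<^sup>2) * ?X h + ennreal (2 * (K * C\<^sup>2 * \<bar>h\<bar>)\<^sup>2 * measure M (space M)))
      \<longlongrightarrow> ennreal (2 * K\<^sup>2) * 0 + ennreal (2 * (K * C\<^sup>2 * \<bar>0\<bar>)\<^sup>2 * measure M (space M))) (at 0)"
    by (intro tendsto_add ennreal_tendsto_cmult path_derivative[unfolded L2_tendsto_def] tendsto_ennrealI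
        tendsto_intros) simp
  then have lim0: "((\<lambda>h. ennreal (2 * K\<^sup>2) * ?X h + ennreal (2 * (K * C\<^sup>2 * \<bar>h\<bar>)\<^sup>2 * measure M (space M)))
      \<longlongrightarrow> 0) (at 0)" by simp
  show "L2_tendsto M q (\<lambda>x. g (\<phi> t x) * \<psi> x) (at 0)"
    unfolding L2_tendsto_def by (rule tendsto_sandwich[OF _ upper tendsto_const lim0]) simp
qed

text \<open>With weight 1 this serves both the double-well energy and the conservation of
  volume.\<close>

lemma tendsto_integral_quotient_mult:
  assumes "quadratic_remainder G g K" and "integrable M w"
  shows "((\<lambda>h. \<integral>x. (G (\<phi> (t + h) x) - G (\<phi> t x)) / h * w x \<partial>M)
    \<longlongrightarrow> (\<integral>x. g (\<phi> t x) * \<psi> x * w x \<partial>M)) (at 0)"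
  using tendsto_integral_bounded_mult[OF difference_quotient[OF assms(1)] assms(2)] .

lemma tendsto_integral_quotient_inner:
  fixes a :: "real \<Rightarrow> 'a \<Rightarrow> 'b::euclidean_space"
  assumes G: "quadratic_remainder G g K"
    and "\<forall>\<^sub>F h in at 0. square_integrable M (a h)" "square_integrable M a'" "L2_tendsto M a a' (at 0)"
    and "square_integrable M b"
  shows "((\<lambda>h. \<integral>x. (G (\<phi> (t + h) x) - G (\<phi> t x)) / h * (a h x \<bullet> b x) \<partial>M)
    \<longlongrightarrow> (\<integral>x. g (\<phi> t x) * \<psi> x * (a' x \<bullet> b x) \<partial>M)) (at 0)"
proof -
  have "0 \<le> 2 * K * C" using G C_nonneg by (simp add: quadratic_remainder_def)
  from tendsto_integral_bounded_mult_inner[OF this difference_quotient[OF G] assms(2-)]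
  show ?thesis .
qed

lemma integrable_comp_mult:
  assumes G: "quadratic_remainder G g K" and \<tau>: "\<tau> > 0" and w: "integrable M w"
  shows "integrable M (\<lambda>x. G (\<phi> \<tau> x) * w x)"
proof (rule integrable_bounded_mult[OF w])
  have "G \<in> borel_measurable borel" using G by (simp add: quadratic_remainder_def)
  then show "(\<lambda>x. G (\<phi> \<tau> x)) \<in> borel_measurable M"
    using path_measurable[OF \<tau>] by (rule measurable_compose_rev)
  \<comment> \<open>Expansion at 0: over [0, 1] the linear term and the remainder contribute at most
    \<open>K\<close> each.\<close>
  show "AE x in M. \<bar>G (\<phi> \<tau> x)\<bar> \<le> \<bar>G 0\<bar> + 2 * K"
    using path_range[OF \<tau>]
  proof eventually_elim
    case (elim x)
    let ?b = "\<phi> \<tau> x"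
    have K: "K \<ge> 0" and rem: "\<forall>a\<in>{0..1}. \<bar>g a\<bar> \<le> K \<and>
        (\<forall>b\<in>{0..1}. \<bar>G b - G a - g a * (b - a)\<bar> \<le> K * (b - a)\<^sup>2)"
      using G by (simp_all add: quadratic_remainder_def)
    from bspec[OF rem, of 0] elim
    have g: "\<bar>g 0\<bar> \<le> K" and R: "\<bar>G ?b - G 0 - g 0 * (?b - 0)\<bar> \<le> K * (?b - 0)\<^sup>2"
      by auto
    have "\<bar>g 0 * ?b\<bar> \<le> K * 1" unfolding abs_mult by (rule mult_mono) (use g elim K in auto)
    moreover have "K * ?b\<^sup>2 \<le> K * 1"
      by (rule mult_left_mono) (use elim K in \<open>auto simp: power_le_one\<close>)
    ultimately show ?case using R by simp
  qed
qed

text \<open>Abstract elasticity: \<open>S\<close> stands for the strain, \<open>A\<close> for the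
  stiffness tensor, \<open>U\<close> for the displacement, \<open>l\<close> for the work of the
  surface traction. The assumption \<open>weak\<close> is the problem at time \<sigma> tested with
  the solution at time \<rho>; \<kappa> and \<open>m\<close> provide ellipticity.\<close>

context
  fixes S :: "real \<Rightarrow> 'a \<Rightarrow> 'b::euclidean_space" and A :: "'b \<Rightarrow> 'b"
    and U :: "real \<Rightarrow> 'a \<Rightarrow> 'c::euclidean_space" and f :: "'a \<Rightarrow> 'c"
    and l :: "real \<Rightarrow> real" and Ge ge Gf gf :: "real \<Rightarrow> real" and Ke Kf m \<kappa> :: real
  assumes Ge: "quadratic_remainder Ge ge Ke" and Gf: "quadratic_remainder Gf gf Kf"
    and m: "m > 0" "\<And>a. a \<in> {0..1} \<Longrightarrow> m \<le> Ge a"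
    and A: "bounded_linear A" "\<And>X Y. A X \<bullet> Y = X \<bullet> A Y"
    and \<kappa>: "\<kappa> > 0" "\<And>X. \<kappa> * (norm X)\<^sup>2 \<le> A X \<bullet> X"
    and S: "\<And>\<tau>. \<tau> > 0 \<Longrightarrow> square_integrable M (S \<tau>)"
    and U: "\<And>\<tau>. \<tau> > 0 \<Longrightarrow> square_integrable M (U \<tau>)"
    and f: "square_integrable M f"
    and U_lim: "L2_tendsto M (\<lambda>h. U (t + h)) (U t) (at 0)"
    and weak: "\<And>\<sigma> \<rho>. \<sigma> > 0 \<Longrightarrow> \<rho> > 0 \<Longrightarrow>
      (\<integral>x. Ge (\<phi> \<sigma> x) * (A (S \<sigma> x) \<bullet> S \<rho> x) \<partial>M) = l \<rho> + (\<integral>x. Gf (\<phi> \<sigma> x) * (f x \<bullet> U \<rho> x) \<partial>M)"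
begin

lemma square_integrable_A: "\<tau> > 0 \<Longrightarrow> square_integrable M (\<lambda>x. A (S \<tau> x))"
  by (rule square_integrable_bounded_linear[OF A(1) S])

lemma eventually_square_integrable:
  "\<forall>\<^sub>F h in at 0. square_integrable M (S (t + h))" "\<forall>\<^sub>F h in at 0. square_integrable M (U (t + h))"
  using eventually_pos by (eventually_elim, simp add: S U)+

lemma integrable_elastic:
  assumes "\<tau> > 0" "\<sigma> > 0" "\<rho> > 0"
  shows "integrable M (\<lambda>x. Ge (\<phi> \<tau> x) * (A (S \<sigma> x) \<bullet> S \<rho> x))"
  using integrable_comp_mult[OF Ge assms(1) integrable_inner[OF square_integrable_A S]] assms by blast

lemma integrable_load:
  assumes "\<tau> > 0" "\<rho> > 0"
  shows "integrable M (\<lambda>x. Gf (\<phi> \<tau> x) * (f x \<bullet> U \<rho> x))"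
  using integrable_comp_mult[OF Gf assms(1) integrable_inner[OF f U]] assms by blast

text \<open>An energy estimate for the difference of two solutions. The right side consists of
  coefficient increments of order \<open>h\<close>, one against the load and one against the old
  stress. Young's inequality absorbs half of the energy from the latter, leaving terms that tend to
  0.\<close>

lemma strain_tendsto: "L2_tendsto M (\<lambda>h. S (t + h)) (S t) (at 0)"
proof -
  define L where "L = 2 * Ke * C"
  define L' where "L' = 2 * Kf * C"
  have L': "L' \<ge> 0" using Gf C_nonneg by (simp add: L'_def quadratic_remainder_def)
  define c where "c = \<kappa> * m"
  have c: "c > 0" using m \<kappa> by (simp add: c_def)
  let ?N = "\<lambda>h. l2norm M (\<lambda>x. S (t + h) x - S t x)"
  let ?R = "\<lambda>h. 2 / c * (L' * \<bar>h\<bar> * (l2norm M f * l2norm M (\<lambda>x. U (t + h) x - U t x))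
      + (L * \<bar>h\<bar>)\<^sup>2 / (2 * c) * (l2norm M (\<lambda>x. A (S t x)))\<^sup>2)"
  have absorb: "x \<le> 2 * (y + z)" if "x \<le> y + (x / 2 + z)" for x y z :: real
    using that by simp
  have est: "\<forall>\<^sub>F h in at 0. (?N h)\<^sup>2 \<le> ?R h"
    using eventually_pos difference_quotient(1)[OF Ge] difference_quotient(1)[OF Gf]
  proof eventually_elim
    case (elim h)
    let ?\<tau> = "t + h"
    have \<tau>: "?\<tau> > 0" and h: "h \<noteq> 0" using elim by auto
    let ?S = "\<lambda>x. S ?\<tau> x - S t x" and ?U = "\<lambda>x. U ?\<tau> x - U t x"
    let ?e = "\<lambda>x. Ge (\<phi> ?\<tau> x) - Ge (\<phi> t x)" and ?f = "\<lambda>x. Gf (\<phi> ?\<tau> x) - Gf (\<phi> t x)"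
    have e_bound: "AE x in M. \<bar>?e x\<bar> \<le> L * \<bar>h\<bar>"
      using conjunct2[OF elim(2)] by eventually_elim (use h in \<open>simp add: L_def divide_le_eq\<close>)
    have f_bound: "AE x in M. \<bar>?f x\<bar> \<le> L' * \<bar>h\<bar>"
      using conjunct2[OF elim(3)] by eventually_elim (use h in \<open>simp add: L'_def divide_le_eq\<close>)
    note sS = square_integrable_diff[OF S[OF \<tau>] S[OF t_pos]]
    note sU = square_integrable_diff[OF U[OF \<tau>] U[OF t_pos]]
    note sA = square_integrable_A[OF t_pos]
    note ints = integrable_elastic[OF \<tau> \<tau> \<tau>] integrable_elastic[OF \<tau> \<tau> t_pos]
      integrable_elastic[OF \<tau> t_pos \<tau>] integrable_elastic[OF \<tau> t_pos t_pos]
      integrable_elastic[OF t_pos t_pos \<tau>] integrable_elastic[OF t_pos t_pos t_pos]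
      integrable_load[OF \<tau> \<tau>] integrable_load[OF \<tau> t_pos]
      integrable_load[OF t_pos \<tau>] integrable_load[OF t_pos t_pos]
    have int_e: "integrable M (\<lambda>x. ?e x * (A (S t x) \<bullet> ?S x))"
      using Bochner_Integration.integrable_diff[OF
          integrable_comp_mult[OF Ge \<tau> integrable_inner[OF sA sS]]
          integrable_comp_mult[OF Ge t_pos integrable_inner[OF sA sS]]]
      by (simp add: left_diff_distrib)
    have int_f: "integrable M (\<lambda>x. ?f x * (f x \<bullet> ?U x))"
      using Bochner_Integration.integrable_diff[OF
          integrable_comp_mult[OF Gf \<tau> integrable_inner[OF f sU]]
          integrable_comp_mult[OF Gf t_pos integrable_inner[OF f sU]]]
      by (simp add: left_diff_distrib)
    have int_E: "integrable M (\<lambda>x. Ge (\<phi> ?\<tau> x) * (A (?S x) \<bullet> ?S x))"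
      using integrable_comp_mult[OF Ge \<tau>
          integrable_inner[OF square_integrable_bounded_linear[OF A(1) sS] sS]] .
    \<comment> \<open>The integrand is arranged so that all four pairs of the times \<open>t\<close>
      and \<open>?\<tau>\<close> occur in the weak form. The values of \<open>l\<close> then cancel
      in pairs.\<close>
    have "(\<integral>x. Ge (\<phi> ?\<tau> x) * (A (?S x) \<bullet> ?S x) \<partial>M)
        = (\<integral>x. Ge (\<phi> ?\<tau> x) * (A (S ?\<tau> x) \<bullet> S ?\<tau> x) - Ge (\<phi> ?\<tau> x) * (A (S ?\<tau> x) \<bullet> S t x)
            - (Ge (\<phi> t x) * (A (S t x) \<bullet> S ?\<tau> x) - Ge (\<phi> t x) * (A (S t x) \<bullet> S t x))
            - ?e x * (A (S t x) \<bullet> ?S x) \<partial>M)"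
      by (rule Bochner_Integration.integral_cong)
        (simp_all add: linear_diff[OF bounded_linear.linear[OF A(1)]] inner_diff algebra_simps)
    also have "\<dots> = (\<integral>x. Gf (\<phi> ?\<tau> x) * (f x \<bullet> U ?\<tau> x) \<partial>M) - (\<integral>x. Gf (\<phi> ?\<tau> x) * (f x \<bullet> U t x) \<partial>M)
            - ((\<integral>x. Gf (\<phi> t x) * (f x \<bullet> U ?\<tau> x) \<partial>M) - (\<integral>x. Gf (\<phi> t x) * (f x \<bullet> U t x) \<partial>M))
            - (\<integral>x. ?e x * (A (S t x) \<bullet> ?S x) \<partial>M)"
      using ints int_e by (simp add: weak[OF \<tau> \<tau>] weak[OF \<tau> t_pos] weak[OF t_pos \<tau>] weak[OF t_pos t_pos])
    also have "\<dots> = (\<integral>x. ?f x * (f x \<bullet> ?U x) \<partial>M) - (\<integral>x. ?e x * (A (S t x) \<bullet> ?S x) \<partial>M)"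
    proof -
      have "(\<integral>x. ?f x * (f x \<bullet> ?U x) \<partial>M) = (\<integral>x. Gf (\<phi> ?\<tau> x) * (f x \<bullet> U ?\<tau> x) - Gf (\<phi> ?\<tau> x) * (f x \<bullet> U t x)
            - (Gf (\<phi> t x) * (f x \<bullet> U ?\<tau> x) - Gf (\<phi> t x) * (f x \<bullet> U t x)) \<partial>M)"
        by (rule Bochner_Integration.integral_cong) (simp_all add: inner_diff algebra_simps)
      with ints show ?thesis by simp
    qed
    finally have energy: "(\<integral>x. Ge (\<phi> ?\<tau> x) * (A (?S x) \<bullet> ?S x) \<partial>M)
        = (\<integral>x. ?f x * (f x \<bullet> ?U x) \<partial>M) - (\<integral>x. ?e x * (A (S t x) \<bullet> ?S x) \<partial>M)" .
    have "c * (?N h)\<^sup>2 = (\<integral>x. c * (norm (?S x))\<^sup>2 \<partial>M)"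
      by (simp add: l2norm_power2)
    also have "\<dots> \<le> (\<integral>x. Ge (\<phi> ?\<tau> x) * (A (?S x) \<bullet> ?S x) \<partial>M)"
    proof (rule integral_mono_AE[OF _ int_E])
      show "integrable M (\<lambda>x. c * (norm (?S x))\<^sup>2)" using square_integrable_integrable[OF sS] by simp
      show "AE x in M. c * (norm (?S x))\<^sup>2 \<le> Ge (\<phi> ?\<tau> x) * (A (?S x) \<bullet> ?S x)"
        using path_range[OF \<tau>]
      proof eventually_elim
        case (elim x)
        have "m * (\<kappa> * (norm (?S x))\<^sup>2) \<le> Ge (\<phi> ?\<tau> x) * (A (?S x) \<bullet> ?S x)"
          using m(2)[OF elim] m(1) \<kappa> by (intro mult_mono) auto
        then show ?case by (simp add: c_def ac_simps)
      qed
    qed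
    also have "\<dots> \<le> L' * \<bar>h\<bar> * (l2norm M f * l2norm M ?U)
        + (c / 2 * (?N h)\<^sup>2 + (L * \<bar>h\<bar>)\<^sup>2 / (2 * c) * (l2norm M (\<lambda>x. A (S t x)))\<^sup>2)"
    proof -
      have "(\<integral>x. ?f x * (f x \<bullet> ?U x) \<partial>M) \<le> (\<integral>x. L' * \<bar>h\<bar> * (norm (f x) * norm (?U x)) \<partial>M)"
      proof (rule integral_mono_AE[OF int_f])
        show "integrable M (\<lambda>x. L' * \<bar>h\<bar> * (norm (f x) * norm (?U x)))"
          using integrable_norm_mult[OF f sU] by simp
        show "AE x in M. ?f x * (f x \<bullet> ?U x) \<le> L' * \<bar>h\<bar> * (norm (f x) * norm (?U x))"
          using f_bound
        proof eventually_elim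
          case (elim x)
          have "\<bar>?f x\<bar> * \<bar>f x \<bullet> ?U x\<bar> \<le> L' * \<bar>h\<bar> * (norm (f x) * norm (?U x))"
            using elim Cauchy_Schwarz_ineq2[of "f x" "?U x"] L' by (intro mult_mono) auto
          then show ?case using abs_ge_self[of "?f x * (f x \<bullet> ?U x)"] by (simp only: abs_mult)
        qed
      qed
      also have "\<dots> \<le> L' * \<bar>h\<bar> * (l2norm M f * l2norm M ?U)"
        using mult_left_mono[OF integral_norm_mult_le[OF f sU], of "L' * \<bar>h\<bar>"] L' by simp
      finally have 1: "(\<integral>x. ?f x * (f x \<bullet> ?U x) \<partial>M) \<le> L' * \<bar>h\<bar> * (l2norm M f * l2norm M ?U)" .
      \<comment> \<open>The coefficient increment multiplies the unknown strain difference, so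
        smallness has to come from Young's inequality with weight \<open>c\<close>: the half with
        \<open>?S\<close> goes to the left, the other carries \<open>h\<^sup>2\<close>.\<close>
      have "- (\<integral>x. ?e x * (A (S t x) \<bullet> ?S x) \<partial>M) = (\<integral>x. - (?e x * (A (S t x) \<bullet> ?S x)) \<partial>M)"
        by simp
      also have "\<dots> \<le> (\<integral>x. c / 2 * (norm (?S x))\<^sup>2 + (L * \<bar>h\<bar>)\<^sup>2 / (2 * c) * (norm (A (S t x)))\<^sup>2 \<partial>M)"
      proof (rule integral_mono_AE)
        show "integrable M (\<lambda>x. - (?e x * (A (S t x) \<bullet> ?S x)))" using int_e by simp
        show "integrable M (\<lambda>x. c / 2 * (norm (?S x))\<^sup>2 + (L * \<bar>h\<bar>)\<^sup>2 / (2 * c) * (norm (A (S t x)))\<^sup>2)"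
          using square_integrable_integrable[OF sS] square_integrable_integrable[OF sA] by simp
        show "AE x in M. - (?e x * (A (S t x) \<bullet> ?S x))
            \<le> c / 2 * (norm (?S x))\<^sup>2 + (L * \<bar>h\<bar>)\<^sup>2 / (2 * c) * (norm (A (S t x)))\<^sup>2"
          using e_bound
        proof eventually_elim
          case (elim x)
          let ?n = "norm (?S x)" and ?a = "L * \<bar>h\<bar> * norm (A (S t x))"
          have "\<bar>?e x\<bar> * \<bar>A (S t x) \<bullet> ?S x\<bar> \<le> L * \<bar>h\<bar> * (norm (A (S t x)) * ?n)"
            using elim Cauchy_Schwarz_ineq2[of "A (S t x)" "?S x"] by (intro mult_mono) auto
          also have "\<dots> \<le> c / 2 * ?n\<^sup>2 + ?a\<^sup>2 / (2 * c)"
            using weighted_AM_GM[OF c, of ?n ?a] by (simp add: ac_simps)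
          finally show ?case
            using abs_ge_minus_self[of "?e x * (A (S t x) \<bullet> ?S x)"]
            by (simp add: abs_mult power_mult_distrib)
        qed
      qed
      also have "\<dots> = c / 2 * (?N h)\<^sup>2 + (L * \<bar>h\<bar>)\<^sup>2 / (2 * c) * (l2norm M (\<lambda>x. A (S t x)))\<^sup>2"
        using square_integrable_integrable[OF sS] square_integrable_integrable[OF sA]
        by (simp add: l2norm_power2)
      finally show ?thesis using 1 unfolding energy by linarith
    qed
    finally have "c * (?N h)\<^sup>2 \<le> L' * \<bar>h\<bar> * (l2norm M f * l2norm M ?U)
        + (c * (?N h)\<^sup>2 / 2 + (L * \<bar>h\<bar>)\<^sup>2 / (2 * c) * (l2norm M (\<lambda>x. A (S t x)))\<^sup>2)"
      by simp
    then have "c * (?N h)\<^sup>2 \<le> 2 * (L' * \<bar>h\<bar> * (l2norm M f * l2norm M ?U)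
        + (L * \<bar>h\<bar>)\<^sup>2 / (2 * c) * (l2norm M (\<lambda>x. A (S t x)))\<^sup>2)"
      by (rule absorb)
    also have "\<dots> = c * ?R h" using c by simp
    finally have "c * (?N h)\<^sup>2 \<le> c * ?R h" .
    then show ?case using c by (simp only: mult_le_cancel_left_pos)
  qed
  have Uh: "((\<lambda>h. l2norm M (\<lambda>x. U (t + h) x - U t x)) \<longlongrightarrow> 0) (at 0)"
    using U_lim by (simp add: L2_tendsto_l2norm eventually_square_integrable U t_pos)
  have "(?R \<longlongrightarrow> 2 / c * (L' * \<bar>0\<bar> * (l2norm M f * 0)
      + (L * \<bar>0\<bar>)\<^sup>2 / (2 * c) * (l2norm M (\<lambda>x. A (S t x)))\<^sup>2)) (at 0)"
    by (intro tendsto_intros Uh) (use c in simp)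
  then have lim0: "(?R \<longlongrightarrow> 0) (at 0)" by simp
  have "((\<lambda>h. (?N h)\<^sup>2) \<longlongrightarrow> 0) (at 0)"
    by (rule tendsto_sandwich[OF _ est tendsto_const lim0]) simp
  from tendsto_real_sqrt[OF this] have "(?N \<longlongrightarrow> 0) (at 0)"
    by (simp add: l2norm_nonneg)
  then show ?thesis
    by (simp add: L2_tendsto_l2norm eventually_square_integrable S t_pos)
qed

text \<open>The two cross-tested equations determine \<open>l (t + h) - l t\<close>, which is never
  differentiated by itself. Both load integrals have the same limit, whence the factor 2; the
  elastic one enters with a minus sign.\<close>

lemma compliance_derivative:
  defines "cpl \<equiv> \<lambda>\<tau>. l \<tau> + (\<integral>x. Gf (\<phi> \<tau> x) * (f x \<bullet> U \<tau> x) \<partial>M)"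
  shows "((\<lambda>h. (cpl (t + h) - cpl t) / h) \<longlongrightarrow>
    2 * (\<integral>x. gf (\<phi> t x) * \<psi> x * (f x \<bullet> U t x) \<partial>M)
      - (\<integral>x. ge (\<phi> t x) * \<psi> x * (A (S t x) \<bullet> S t x) \<partial>M)) (at 0)"
proof -
  let ?qe = "\<lambda>h x. (Ge (\<phi> (t + h) x) - Ge (\<phi> t x)) / h"
  let ?qf = "\<lambda>h x. (Gf (\<phi> (t + h) x) - Gf (\<phi> t x)) / h"
  have "\<forall>\<^sub>F h in at 0. (\<integral>x. ?qf h x * (U (t + h) x \<bullet> f x) \<partial>M) + (\<integral>x. ?qf h x * (U t x \<bullet> f x) \<partial>M)
      - (\<integral>x. ?qe h x * (S (t + h) x \<bullet> A (S t x)) \<partial>M) = (cpl (t + h) - cpl t) / h"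
    using eventually_pos
  proof eventually_elim
    case (elim h)
    let ?\<tau> = "t + h"
    have \<tau>: "?\<tau> > 0" and h: "h \<noteq> 0" using elim by auto
    have sym: "A (S ?\<tau> x) \<bullet> S t x = A (S t x) \<bullet> S ?\<tau> x" for x
      by (metis A(2) inner_commute)
    have 1: "(\<integral>x. ?qf h x * (U \<rho> x \<bullet> f x) \<partial>M)
        = ((\<integral>x. Gf (\<phi> ?\<tau> x) * (f x \<bullet> U \<rho> x) \<partial>M) - (\<integral>x. Gf (\<phi> t x) * (f x \<bullet> U \<rho> x) \<partial>M)) / h"
      if "\<rho> > 0" for \<rho>
    proof -
      have "(\<integral>x. ?qf h x * (U \<rho> x \<bullet> f x) \<partial>M)
          = (\<integral>x. (Gf (\<phi> ?\<tau> x) * (f x \<bullet> U \<rho> x) - Gf (\<phi> t x) * (f x \<bullet> U \<rho> x)) / h \<partial>M)"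
        by (rule Bochner_Integration.integral_cong) (simp_all add: inner_commute algebra_simps)
      with integrable_load[OF \<tau> that] integrable_load[OF t_pos that] show ?thesis by simp
    qed
    have 2: "(\<integral>x. ?qe h x * (S ?\<tau> x \<bullet> A (S t x)) \<partial>M)
        = ((\<integral>x. Ge (\<phi> ?\<tau> x) * (A (S ?\<tau> x) \<bullet> S t x) \<partial>M) - (\<integral>x. Ge (\<phi> t x) * (A (S t x) \<bullet> S ?\<tau> x) \<partial>M)) / h"
    proof -
      \<comment> \<open>Symmetry puts \<open>A\<close> on the strain at the fixed time
        \<open>t\<close>, so only the factor \<open>S ?\<tau>\<close> moves with \<open>h\<close>,
        and \<open>strain_tendsto\<close> applies to it directly.\<close>
      have "(\<integral>x. ?qe h x * (S ?\<tau> x \<bullet> A (S t x)) \<partial>M)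
          = (\<integral>x. (Ge (\<phi> ?\<tau> x) * (A (S ?\<tau> x) \<bullet> S t x) - Ge (\<phi> t x) * (A (S t x) \<bullet> S ?\<tau> x)) / h \<partial>M)"
        by (rule Bochner_Integration.integral_cong) (simp_all add: A(2)[symmetric] sym left_diff_distrib)
      with integrable_elastic[OF \<tau> \<tau> t_pos] integrable_elastic[OF t_pos t_pos \<tau>] show ?thesis by simp
    qed
    show ?case
      unfolding 1[OF \<tau>] 1[OF t_pos] 2 weak[OF \<tau> t_pos] weak[OF t_pos \<tau>] cpl_def
      using h by (simp add: field_simps)
  qed
  moreover have "((\<lambda>h. (\<integral>x. ?qf h x * (U (t + h) x \<bullet> f x) \<partial>M) + (\<integral>x. ?qf h x * (U t x \<bullet> f x) \<partial>M)
      - (\<integral>x. ?qe h x * (S (t + h) x \<bullet> A (S t x)) \<partial>M)) \<longlongrightarrow>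
      (\<integral>x. gf (\<phi> t x) * \<psi> x * (U t x \<bullet> f x) \<partial>M) + (\<integral>x. gf (\<phi> t x) * \<psi> x * (U t x \<bullet> f x) \<partial>M)
      - (\<integral>x. ge (\<phi> t x) * \<psi> x * (S t x \<bullet> A (S t x)) \<partial>M)) (at 0)"
    by (intro tendsto_intros tendsto_integral_quotient_inner[OF Gf]
        tendsto_integral_quotient_inner[OF Ge] L2_tendsto_const always_eventually allI eventually_square_integrable U[OF t_pos] S[OF t_pos] U_lim strain_tendsto f
        square_integrable_A[OF t_pos] integrable_inner)
  ultimately show ?thesis
    by (rule Lim_transform_eventually[rotated, THEN tendsto_eq_rhs]) (simp add: inner_commute)
qed

end

end

text \<open>Expanding the square around \<open>g t\<close> gives \<open>h\<close> times the squared
  norm of the quotient plus twice its product with \<open>g t\<close>. The squared norms converge,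
  so the extra factor \<open>h\<close> removes the first term.\<close>

lemma tendsto_norm_power2_quotient:
  fixes g :: "real \<Rightarrow> 'a \<Rightarrow> 'b::euclidean_space"
  assumes g: "\<forall>\<^sub>F h in at 0. square_integrable M (g (t + h))" "square_integrable M (g t)"
    and g': "square_integrable M g'"
    and lim: "L2_tendsto M (\<lambda>h x. (1 / h) *\<^sub>R (g (t + h) x - g t x)) g' (at 0)"
  shows "((\<lambda>h. ((\<integral>x. (norm (g (t + h) x))\<^sup>2 \<partial>M) - (\<integral>x. (norm (g t x))\<^sup>2 \<partial>M)) / h)
    \<longlongrightarrow> 2 * (\<integral>x. g t x \<bullet> g' x \<partial>M)) (at 0)"
proof -
  let ?d = "\<lambda>h x. (1 / h) *\<^sub>R (g (t + h) x - g t x)"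
  have lin: "(\<integral>x. c * p x + 2 * q x \<partial>M) = c * (\<integral>x. p x \<partial>M) + 2 * (\<integral>x. q x \<partial>M)"
    if "integrable M p" "integrable M q" for c :: real and p q
    using that by simp
  have sd: "\<forall>\<^sub>F h in at 0. square_integrable M (?d h)"
    using g(1)
    by eventually_elim
      (intro square_integrable_bounded_linear[OF bounded_linear_scaleR_right] square_integrable_diff g(2))
  have "((\<lambda>h. h * (\<integral>x. ?d h x \<bullet> ?d h x \<partial>M) + 2 * (\<integral>x. g t x \<bullet> ?d h x \<partial>M))
      \<longlongrightarrow> 0 * (\<integral>x. g' x \<bullet> g' x \<partial>M) + 2 * (\<integral>x. g t x \<bullet> g' x \<partial>M)) (at 0)"
    by (intro tendsto_intros tendsto_integral_inner sd g g' lim L2_tendsto_const always_eventually allI)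
  moreover have "\<forall>\<^sub>F h in at 0. h * (\<integral>x. ?d h x \<bullet> ?d h x \<partial>M) + 2 * (\<integral>x. g t x \<bullet> ?d h x \<partial>M)
      = ((\<integral>x. (norm (g (t + h) x))\<^sup>2 \<partial>M) - (\<integral>x. (norm (g t x))\<^sup>2 \<partial>M)) / h"
    using g(1) sd eventually_neq_at_within[of 0 0 UNIV]
  proof eventually_elim
    case (elim h)
    have "((\<integral>x. (norm (g (t + h) x))\<^sup>2 \<partial>M) - (\<integral>x. (norm (g t x))\<^sup>2 \<partial>M)) / h
        = (\<integral>x. ((norm (g (t + h) x))\<^sup>2 - (norm (g t x))\<^sup>2) / h \<partial>M)"
      using square_integrable_integrable[OF elim(1)] square_integrable_integrable[OF g(2)] by simp
    also have "\<dots> = (\<integral>x. h * (?d h x \<bullet> ?d h x) + 2 * (g t x \<bullet> ?d h x) \<partial>M)"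
    proof (rule Bochner_Integration.integral_cong[OF refl])
      fix x
      have expand: "(norm (a + h *\<^sub>R d))\<^sup>2 - (norm a)\<^sup>2 = h * (h * (d \<bullet> d) + 2 * (a \<bullet> d))" for a d :: 'b
        by (simp add: power2_norm_eq_inner inner_add inner_commute[of d a] algebra_simps)
      have eq: "g (t + h) x = g t x + h *\<^sub>R ?d h x" using elim(3) by simp
      have "(norm (g (t + h) x))\<^sup>2 - (norm (g t x))\<^sup>2 = h * (h * (?d h x \<bullet> ?d h x) + 2 * (g t x \<bullet> ?d h x))"
        using expand[of "g t x" "?d h x"] by (simp only: eq[symmetric])
      then show "((norm (g (t + h) x))\<^sup>2 - (norm (g t x))\<^sup>2) / h
          = h * (?d h x \<bullet> ?d h x) + 2 * (g t x \<bullet> ?d h x)"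
        using elim(3) by (simp only: nonzero_mult_div_cancel_left not_False_eq_True)
    qed
    also have "\<dots> = h * (\<integral>x. ?d h x \<bullet> ?d h x \<partial>M) + 2 * (\<integral>x. g t x \<bullet> ?d h x \<partial>M)"
      by (rule lin) (rule integrable_inner[OF elim(2) elim(2)] integrable_inner[OF g(2) elim(2)])+
    finally show ?case by simp
  qed
  ultimately show ?thesis
    by (rule Lim_transform_eventually[THEN tendsto_eq_rhs]) simp
qed

section \<open>Material interpolation\<close>

lemma quadratic_remainder_interp:
  assumes "0 < m" "m < 1"
  shows "quadratic_remainder (interp m) (deriv (interp m)) 3"
proof -
  have deriv: "deriv (interp m) = (\<lambda>r. 3 * (1 - m) * r\<^sup>2)"
  proof
    fix r
    have "(interp m has_real_derivative 3 * (1 - m) * r\<^sup>2) (at r)"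
      unfolding interp_def[abs_def] by (auto intro!: derivative_eq_intros)
    then show "deriv (interp m) r = 3 * (1 - m) * r\<^sup>2" by (rule DERIV_imp_deriv)
  qed
  have bounds: "\<bar>3 * (1 - m) * a\<^sup>2\<bar> \<le> 3 \<and>
      \<bar>interp m b - interp m a - 3 * (1 - m) * a\<^sup>2 * (b - a)\<bar> \<le> 3 * (b - a)\<^sup>2"
    if "a \<in> {0..1}" "b \<in> {0..1}" for a b :: real
  proof
    have "\<bar>1 - m\<bar> * \<bar>a\<^sup>2\<bar> \<le> 1 * 1"
      by (rule mult_mono) (use assms that in \<open>auto simp: power_le_one\<close>)
    then show "\<bar>3 * (1 - m) * a\<^sup>2\<bar> \<le> 3" unfolding abs_mult by simp
    \<comment> \<open>The remainder of the cube is exactly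
      \<open>(b + 2 * a) * (b - a)\<^sup>2\<close>, and \<open>b + 2 * a\<close> is at most 3 on
      [0, 1]; the derivative has the same bound 3.\<close>
    have "interp m b - interp m a - 3 * (1 - m) * a\<^sup>2 * (b - a) = ((1 - m) * (b + 2 * a)) * (b - a)\<^sup>2"
      by (simp add: interp_def power2_eq_square power3_eq_cube algebra_simps)
    moreover have "\<bar>1 - m\<bar> * \<bar>b + 2 * a\<bar> \<le> 1 * 3"
      by (rule mult_mono) (use assms that in auto)
    then have "\<bar>1 - m\<bar> * \<bar>b + 2 * a\<bar> * (b - a)\<^sup>2 \<le> 3 * (b - a)\<^sup>2"
      by (intro mult_right_mono) auto
    ultimately show "\<bar>interp m b - interp m a - 3 * (1 - m) * a\<^sup>2 * (b - a)\<bar> \<le> 3 * (b - a)\<^sup>2"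
      by (simp add: abs_mult)
  qed
  have "interp m \<in> borel_measurable borel" "(\<lambda>r. 3 * (1 - m) * r\<^sup>2) \<in> borel_measurable borel"
    unfolding interp_def[abs_def] by measurable
  with bounds show ?thesis unfolding quadratic_remainder_def deriv by simp
qed

lemma quadratic_remainder_double_well:
  "quadratic_remainder double_well (deriv double_well) 4"
proof -
  have deriv: "deriv double_well = (\<lambda>r. (r * (1 - r) * (1 - 2 * r)) / 2)"
  proof
    fix r
    have "(double_well has_real_derivative (r * (1 - r) * (1 - 2 * r)) / 2) (at r)"
      unfolding double_well_def[abs_def]
      by (auto intro!: derivative_eq_intros simp: field_simps power2_eq_square power3_eq_cube)
    then show "deriv double_well r = (r * (1 - r) * (1 - 2 * r)) / 2" by (rule DERIV_imp_deriv)
  qed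
  have bounds: "\<bar>(a * (1 - a) * (1 - 2 * a)) / 2\<bar> \<le> 4 \<and>
      \<bar>double_well b - double_well a - (a * (1 - a) * (1 - 2 * a)) / 2 * (b - a)\<bar> \<le> 4 * (b - a)\<^sup>2"
    if "a \<in> {0..1}" "b \<in> {0..1}" for a b :: real
  proof
    have "\<bar>a\<bar> * \<bar>1 - a\<bar> * \<bar>1 - 2 * a\<bar> \<le> 1 * 1 * 1"
      by (intro mult_mono) (use that in auto)
    then show "\<bar>(a * (1 - a) * (1 - 2 * a)) / 2\<bar> \<le> 4" by (simp add: abs_mult)
    \<comment> \<open>The products \<open>a * a\<close>, \<open>b * b\<close> and
      \<open>a * b\<close> are treated as independent numbers in [0, 1], which makes the bound
      linear. The numerator lies between -5 and 7, so 4 is generous.\<close>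
    have Q_bound: "\<bar>(1 - 2 * (b + 2 * a) + q + 2 * r + 3 * p) / 4\<bar> \<le> 4"
      if "0 \<le> p" "p \<le> 1" "0 \<le> q" "q \<le> 1" "0 \<le> r" "r \<le> 1" for p q r :: real
      using that \<open>a \<in> {0..1}\<close> \<open>b \<in> {0..1}\<close> by (auto simp: abs_le_iff)
    \<comment> \<open>The remainders of the square, the cube and the fourth power, each divided by
      \<open>(b - a)\<^sup>2\<close>, are 1, \<open>b + 2 * a\<close> and
      \<open>b * b + 2 * (a * b) + 3 * (a * a)\<close>.\<close>
    let ?Q = "(1 - 2 * (b + 2 * a) + b * b + 2 * (a * b) + 3 * (a * a)) / 4"
    have "double_well b - double_well a - (a * (1 - a) * (1 - 2 * a)) / 2 * (b - a) = ?Q * (b - a)\<^sup>2"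
      by (simp add: double_well_def power2_eq_square field_simps)
    moreover have "\<bar>?Q\<bar> \<le> 4"
    proof -
      have "0 \<le> a * a" "a * a \<le> 1" "0 \<le> b * b" "b * b \<le> 1" "0 \<le> a * b" "a * b \<le> 1"
        using that by (auto simp: mult_le_one)
      then show ?thesis by (rule Q_bound)
    qed
    then have "\<bar>?Q\<bar> * (b - a)\<^sup>2 \<le> 4 * (b - a)\<^sup>2" by (intro mult_right_mono) auto
    ultimately show "\<bar>double_well b - double_well a - (a * (1 - a) * (1 - 2 * a)) / 2 * (b - a)\<bar> \<le> 4 * (b - a)\<^sup>2"
      by (simp only: abs_mult abs_power2)
  qed
  have "double_well \<in> borel_measurable borel"
    "(\<lambda>r::real. (r * (1 - r) * (1 - 2 * r)) / 2) \<in> borel_measurable borel"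
    unfolding double_well_def[abs_def] by measurable
  with bounds show ?thesis unfolding quadratic_remainder_def deriv by simp
qed

text \<open>Serves the volume constraint, where the path itself is integrated.\<close>

lemma quadratic_remainder_ident: "quadratic_remainder (\<lambda>r. r) (\<lambda>_. 1) 1"
  by (simp add: quadratic_remainder_def)

section \<open>Symmetry and coercivity of the isotropic stiffness tensor\<close>

lemma inner_mat_1: "(mat 1 :: real^'n^'n) \<bullet> B = trace B"
  by (simp add: inner_vec_def mat_def trace_def if_distrib if_distribR sum.delta cong: if_cong)

lemma inner_transpose: "transpose A \<bullet> B = A \<bullet> transpose B" for A B :: "real^'n^'n"
  unfolding inner_vec_def transpose_def by (simp, subst sum.swap, simp)

lemma bounded_linear_transpose: "bounded_linear (transpose :: real^'n^'n \<Rightarrow> real^'n^'n)"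
  by (intro linear_conv_bounded_linear[THEN iffD1] linearI) (simp_all add: transpose_def vec_eq_iff)

lemma bounded_linear_stiffness: "bounded_linear (stiffness E \<nu> :: real^'n^'n \<Rightarrow> real^'n^'n)"
  by (intro linear_conv_bounded_linear[THEN iffD1] linearI)
    (simp_all add: stiffness_def trace_def sum.distrib sum_distrib_left algebra_simps)

lemma stiffness_symmetric: "stiffness E \<nu> A \<bullet> B = A \<bullet> stiffness E \<nu> B" for A B :: "real^'n^'n"
proof -
  have "A \<bullet> mat 1 = trace A" using inner_mat_1[of A] by (simp add: inner_commute)
  then show ?thesis by (simp add: stiffness_def inner_add inner_mat_1)
qed

lemma transpose_stiffness: "transpose (stiffness E \<nu> A) = stiffness E \<nu> (transpose A)"
  for A :: "real^'n^'n"
  by (simp add: stiffness_def transpose_def trace_def vec_eq_iff mat_def)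

lemma stiffness_coercive:
  fixes A :: "real^'n^'n"
  assumes "E > 0" "0 < \<nu>" "\<nu> < 1/2"
  shows "2 * lame_mu E \<nu> * (norm A)\<^sup>2 \<le> stiffness E \<nu> A \<bullet> A"
proof -
  have "lame_lambda CARD('n) E \<nu> \<ge> 0" using assms by (simp add: lame_lambda_def)
  then have "0 \<le> lame_lambda CARD('n) E \<nu> * (trace A * trace A)" by simp
  then show ?thesis
    by (simp add: stiffness_def inner_add inner_mat_1 power2_norm_eq_inner mult.assoc)
qed

section \<open>Weak formulation\<close>

lemma has_weak_gradient_wgrad: "v \<in> H1 \<Omega> \<Longrightarrow> has_weak_gradient \<Omega> v (wgrad \<Omega> v)"
  using someI_ex[of "has_weak_gradient \<Omega> v"] by (simp add: H1_def wgrad_def)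

lemma square_integrable_H1: "v \<in> H1 \<Omega> \<Longrightarrow> square_integrable (lebesgue_on \<Omega>) v"
  and square_integrable_wgrad: "v \<in> H1 \<Omega> \<Longrightarrow> square_integrable (lebesgue_on \<Omega>) (wgrad \<Omega> v)"
  using has_weak_gradient_wgrad[of v \<Omega>] by (simp_all add: has_weak_gradient_def)

lemma has_weak_divergence_wdiv: "weakly_divergent \<Omega> \<tau> \<Longrightarrow> has_weak_divergence \<Omega> \<tau> (wdiv \<Omega> \<tau>)"
  unfolding weakly_divergent_def wdiv_def by (rule someI_ex[of "has_weak_divergence \<Omega> \<tau>"])

lemma has_trace_btrace: "\<exists>w. has_trace \<Omega> v w \<Longrightarrow> has_trace \<Omega> v (btrace \<Omega> v)"
  unfolding btrace_def by (rule someI_ex[of "has_trace \<Omega> v"])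

lemma square_integrable_vec:
  fixes f :: "'a \<Rightarrow> 'b::euclidean_space^'n"
  assumes f: "\<And>i. square_integrable M (\<lambda>x. f x $ i)"
  shows "square_integrable M f"
proof -
  have axis: "bounded_linear (axis i :: 'b \<Rightarrow> 'b^'n)" for i
    by (intro linear_conv_bounded_linear[THEN iffD1] linearI) (simp_all add: axis_def vec_eq_iff)
  have "square_integrable M (\<lambda>x. \<Sum>i\<in>I. axis i (f x $ i))" if "finite I" for I :: "'n set"
    using that
  proof induction
    case empty
    show ?case by (simp add: square_integrable_def)
  next
    case (insert i I)
    then show ?case
      using square_integrable_add[OF square_integrable_bounded_linear[OF axis f]] by simp
  qed
  moreover have "(\<Sum>i\<in>UNIV. axis i (f x $ i)) = f x" for x
    by (simp add: vec_eq_iff axis_def)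
  ultimately show ?thesis by (metis (no_types, lifting) ext finite)
qed

section \<open>Integration over parts of the boundary\<close>

lemma sets_hausdorff_measure [simp]: "sets (hausdorff_measure k) = sets borel"
  and space_hausdorff_measure [simp]: "space (hausdorff_measure k) = UNIV"
  using sets.space_closed[of borel] sets.sigma_sets_eq[of borel]
  by (simp_all add: hausdorff_measure_def sets_measure_of_conv space_measure_of_conv)

lemma square_integrable_surface_mono:
  fixes f :: "real^'d \<Rightarrow> 'b::euclidean_space"
  assumes "square_integrable (surface B) f" "A \<subseteq> B" "A \<in> sets borel" "B \<in> sets borel"
  shows "square_integrable (surface A) f"
proof -
  have A: "surface A = restrict_space (surface B) A"
    using assms(2-4) by (simp add: surface_def restrict_restrict_space Int_absorb1)
  have sets: "A \<in> sets (surface B)" "A \<inter> space (surface B) \<in> sets (surface B)"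
    using assms(2-4) by (auto simp: surface_def space_restrict_space sets_restrict_space)
  have "integrable (surface A) (\<lambda>x. (norm (f x))\<^sup>2)"
    unfolding A integrable_restrict_space[OF sets(2)]
    by (rule integrable_mult_indicator[OF sets(1) square_integrable_integrable[OF assms(1)]])
  moreover have "f \<in> borel_measurable (surface A)"
    unfolding A using square_integrable_measurable[OF assms(1)] by (rule measurable_restrict_space1)
  ultimately show ?thesis by (simp add: square_integrable_def)
qed

text \<open>The normal trace is integrated over \<open>B - \<Gamma>D\<close>, the work of the
  traction over all of \<open>\<Gamma>T\<close>. The two parts may overlap; on the overlap the trace
  \<open>w\<close> vanishes.\<close>

lemma surface_integral_traction:
  fixes s w :: "real^'d \<Rightarrow> real"
  assumes N: "\<Gamma>T \<subseteq> B" "\<Gamma>T \<in> sets borel" and D: "\<Gamma>D \<in> sets borel" and B: "B \<in> sets borel"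
    and int: "integrable (surface \<Gamma>T) (\<lambda>x. s x * w x)" and zero: "AE x in surface \<Gamma>D. w x = 0"
  shows "(\<integral>x. (if x \<in> \<Gamma>T then s x else 0) * w x \<partial>surface (B - \<Gamma>D)) = (\<integral>x. s x * w x \<partial>surface \<Gamma>T)"
proof -
  let ?H = "hausdorff_measure (CARD('d) - 1) :: (real^'d) measure"
  let ?k = "\<lambda>x. indicator \<Gamma>T x *\<^sub>R (s x * w x)"
  have k: "integrable ?H ?k"
    using int N(2) by (simp add: surface_def integrable_restrict_space)
  have "(\<integral>x. (if x \<in> \<Gamma>T then s x else 0) * w x \<partial>surface (B - \<Gamma>D))
      = (\<integral>x. indicator (B - \<Gamma>D) x *\<^sub>R ((if x \<in> \<Gamma>T then s x else 0) * w x) \<partial>?H)"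
    unfolding surface_def using B D by (intro integral_restrict_space) simp
  also have "\<dots> = (\<integral>x. indicator (- \<Gamma>D) x *\<^sub>R ?k x \<partial>?H)"
    using N(1) by (intro Bochner_Integration.integral_cong) (auto simp: indicator_def)
  also have "\<dots> = (\<integral>x. ?k x \<partial>?H)"
  proof (rule integral_cong_AE)
    show "?k \<in> borel_measurable ?H" using k by simp
    show "(\<lambda>x. indicator (- \<Gamma>D) x *\<^sub>R ?k x) \<in> borel_measurable ?H"
      using integrable_mult_indicator[OF _ k, of "- \<Gamma>D"] D by (simp add: borel_comp)
    have "AE x in ?H. x \<in> \<Gamma>D \<longrightarrow> w x = 0"
      using zero AE_restrict_space_iff[of \<Gamma>D ?H "\<lambda>x. w x = 0"] D unfolding surface_def by simp
    then show "AE x in ?H. indicator (- \<Gamma>D) x *\<^sub>R ?k x = ?k x"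
      by eventually_elim (auto simp: indicator_def)
  qed
  also have "\<dots> = (\<integral>x. s x * w x \<partial>surface \<Gamma>T)"
    unfolding surface_def using N(2) by (simp add: integral_restrict_space)
  finally show ?thesis .
qed

section \<open>Green's formula for the stress\<close>

lemma dirichlet_space_H1: "v \<in> dirichlet_space \<Omega> \<Gamma>D \<Longrightarrow> (\<lambda>x. v x $ i) \<in> H1 \<Omega>"
  by (simp add: dirichlet_space_def)

lemma square_integrable_dirichlet_space:
  "v \<in> dirichlet_space \<Omega> \<Gamma>D \<Longrightarrow> square_integrable (lebesgue_on \<Omega>) v"
  by (intro square_integrable_vec square_integrable_H1 dirichlet_space_H1)

lemma square_integrable_strain:
  assumes "v \<in> dirichlet_space \<Omega> \<Gamma>D"
  shows "square_integrable (lebesgue_on \<Omega>) (strain \<Omega> v)"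
proof -
  have jac: "square_integrable (lebesgue_on \<Omega>) (wjac \<Omega> v)"
    by (rule square_integrable_vec)
      (simp add: wjac_def square_integrable_wgrad[OF dirichlet_space_H1[OF assms]])
  have "square_integrable (lebesgue_on \<Omega>) (\<lambda>x. (1/2) *\<^sub>R (wjac \<Omega> v x + transpose (wjac \<Omega> v x)))"
    by (intro square_integrable_bounded_linear[OF bounded_linear_scaleR_right] square_integrable_add
        square_integrable_bounded_linear[OF bounded_linear_transpose] jac)
  then show ?thesis by (simp add: strain_def[abs_def])
qed

text \<open>The stress is a symmetric matrix, so it pairs equally with the Jacobian of
  \<open>v\<close> and with its transpose, hence with the strain.\<close>

lemma stress_inner_wjac:
  "(\<Sum>i\<in>UNIV. stress \<Omega> m E \<nu> p u x $ i \<bullet> wgrad \<Omega> (\<lambda>y. v y $ i) x)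
    = interp m (p x) * (stiffness E \<nu> (strain \<Omega> u x) \<bullet> strain \<Omega> v x)"
proof -
  let ?T = "stiffness E \<nu> (strain \<Omega> u x)" and ?J = "wjac \<Omega> v x"
  have strain_transpose: "transpose (strain \<Omega> u x) = strain \<Omega> u x"
    by (simp add: strain_def transpose_def vec_eq_iff add.commute)
  have T: "transpose ?T = ?T"
    unfolding transpose_stiffness strain_transpose ..
  then have "?T \<bullet> transpose ?J = ?T \<bullet> ?J" using inner_transpose[of ?T ?J] by simp
  then have "?T \<bullet> strain \<Omega> v x = ?T \<bullet> ?J" by (simp add: strain_def inner_add_right)
  moreover have "(\<Sum>i\<in>UNIV. stress \<Omega> m E \<nu> p u x $ i \<bullet> wgrad \<Omega> (\<lambda>y. v y $ i) x)
      = stress \<Omega> m E \<nu> p u x \<bullet> ?J"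
    by (simp add: inner_vec_def[of "stress \<Omega> m E \<nu> p u x"] wjac_def)
  ultimately show ?thesis by (simp add: stress_def)
qed

text \<open>The normal trace condition is stated for each row of the stress. Row \<open>i\<close> is
  tested with component \<open>i\<close> of \<open>v\<close>; summation over the rows restores the
  tensor products.\<close>

lemma elasticity_weak_form:
  fixes \<Omega> \<Gamma>D \<Gamma>T :: "(real^'d) set"
  assumes D: "\<Gamma>D \<subseteq> frontier \<Omega>" "\<Gamma>D \<in> sets borel"
    and N: "\<Gamma>T \<subseteq> frontier \<Omega>" "\<Gamma>T \<in> sets borel"
    and f: "square_integrable (lebesgue_on \<Omega>) f" and s: "square_integrable (surface \<Gamma>T) s"
    and m: "0 < fmin" "fmin < 1"
    and p: "p \<in> borel_measurable (lebesgue_on \<Omega>)" "AE x in lebesgue_on \<Omega>. p x \<in> {0..1}"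
    and u: "elasticity_solution \<Omega> \<Gamma>D \<Gamma>T Emin fmin E \<nu> f s p u" and v: "v \<in> dirichlet_space \<Omega> \<Gamma>D"
  shows "(\<integral>x. interp Emin (p x) * (stiffness E \<nu> (strain \<Omega> u x) \<bullet> strain \<Omega> v x) \<partial>lebesgue_on \<Omega>)
    = (\<integral>x. s x \<bullet> btrace_vec \<Omega> v x \<partial>surface \<Gamma>T)
      + (\<integral>x. interp fmin (p x) * (f x \<bullet> v x) \<partial>lebesgue_on \<Omega>)"
proof -
  let ?M = "lebesgue_on \<Omega>"
  let ?\<sigma> = "\<lambda>i x. stress \<Omega> Emin E \<nu> p u x $ i" and ?v = "\<lambda>i x. v x $ i"
  let ?b = "\<lambda>i. btrace \<Omega> (?v i)"
  have frontier: "frontier \<Omega> \<in> sets borel" by simp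
  have div: "weakly_divergent \<Omega> (?\<sigma> i)"
    and eq: "AE x in ?M. - wdiv \<Omega> (?\<sigma> i) x = (interp fmin (p x) *\<^sub>R f x) $ i"
    and traction: "has_normal_trace \<Omega> (frontier \<Omega> - \<Gamma>D) (?\<sigma> i) (\<lambda>x. if x \<in> \<Gamma>T then s x $ i else 0)" for i
    using u by (simp_all add: elasticity_solution_def)
  have vH1: "?v i \<in> H1 \<Omega>" for i by (rule dirichlet_space_H1[OF v])
  have zero: "AE x in surface \<Gamma>D. ?b i x = 0" for i
  proof -
    have "AE x in surface \<Gamma>D. btrace_vec \<Omega> v x = 0" using v by (simp add: dirichlet_space_def)
    then show ?thesis by eventually_elim (simp add: btrace_vec_def vec_eq_iff)
  qed
  \<comment> \<open>Membership in the Dirichlet space includes the existence of a trace, so the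
    choice made by \<open>btrace\<close> is a genuine one and is square integrable; this makes the
    traction work integrable.\<close>
  have "has_trace \<Omega> (?v i) (?b i)" for i
    using v by (intro has_trace_btrace) (simp add: dirichlet_space_def)
  then have "square_integrable (surface (frontier \<Omega>)) (?b i)" for i
    unfolding has_trace_def by blast
  then have b: "square_integrable (surface \<Gamma>T) (?b i)" for i
    by (rule square_integrable_surface_mono[OF _ N frontier])
  have comp: "square_integrable M (\<lambda>x. g x $ i)" if "square_integrable M g"
    for M :: "(real^'d) measure" and g :: "real^'d \<Rightarrow> real^'d" and i
    by (rule square_integrable_bounded_linear[OF bounded_linear_vec_nth that])
  have int_s: "integrable (surface \<Gamma>T) (\<lambda>x. s x $ i * ?b i x)" for i
    using integrable_inner[OF comp[OF s] b] by simp
  have interp_meas: "(\<lambda>x. interp fmin (p x)) \<in> borel_measurable ?M"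
    using p(1) unfolding interp_def by measurable
  have interp_bound: "AE x in ?M. \<bar>interp fmin (p x)\<bar> \<le> 2"
    using p(2)
  proof eventually_elim
    case (elim x)
    have "\<bar>1 - fmin\<bar> * \<bar>(p x) ^ 3\<bar> \<le> 1 * 1"
      by (rule mult_mono) (use m elim in \<open>auto simp: power_le_one\<close>)
    then have "\<bar>(1 - fmin) * (p x) ^ 3\<bar> \<le> 1" by (simp add: abs_mult)
    then show ?case using m unfolding interp_def by linarith
  qed
  have int_f: "integrable ?M (\<lambda>x. interp fmin (p x) * (f x $ i * v x $ i))" for i
    using integrable_bounded_mult[OF integrable_inner[OF comp[OF f] square_integrable_H1[OF vH1]]
        interp_meas interp_bound] by simp
  have int_\<sigma>: "integrable ?M (\<lambda>x. ?\<sigma> i x \<bullet> wgrad \<Omega> (?v i) x)" for i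
    using has_weak_divergence_wdiv[OF div]
    by (intro integrable_inner square_integrable_wgrad vH1) (simp add: has_weak_divergence_def)
  have component: "(\<integral>x. ?\<sigma> i x \<bullet> wgrad \<Omega> (?v i) x \<partial>?M)
      = (\<integral>x. s x $ i * ?b i x \<partial>surface \<Gamma>T) + (\<integral>x. interp fmin (p x) * (f x $ i * v x $ i) \<partial>?M)" for i
  proof -
    have wdiv_eq: "AE x in ?M. wdiv \<Omega> (?\<sigma> i) x * v x $ i = - (interp fmin (p x) * (f x $ i * v x $ i))"
      using eq[of i]
    proof eventually_elim
      case (elim x)
      then have "wdiv \<Omega> (?\<sigma> i) x = - (interp fmin (p x) * f x $ i)" by simp
      then show ?case by simp
    qed
    have "wdiv \<Omega> (?\<sigma> i) \<in> borel_measurable ?M"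
      using has_weak_divergence_wdiv[OF div, of i] unfolding has_weak_divergence_def
      by (blast intro: borel_measurable_integrable)
    then have meas: "(\<lambda>x. wdiv \<Omega> (?\<sigma> i) x * v x $ i) \<in> borel_measurable ?M"
      using square_integrable_measurable[OF square_integrable_H1[OF vH1[of i]]] by (rule borel_measurable_times)
    have meas': "(\<lambda>x. - (interp fmin (p x) * (f x $ i * v x $ i))) \<in> borel_measurable ?M"
      using int_f[of i] by (intro borel_measurable_integrable) simp
    \<comment> \<open>Green's formula asks for this integrability. The divergence is only known to
      be integrable in general, but here it equals minus the load, a bounded coefficient times a
      square-integrable force.\<close>
    have "integrable ?M (\<lambda>x. wdiv \<Omega> (?\<sigma> i) x * v x $ i)"
      using integrable_cong_AE[OF meas meas' wdiv_eq] int_f[of i] by simp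
    \<comment> \<open>The complement taken twice turns the admissibility condition for test
      functions into the Dirichlet condition.\<close>
    moreover have "frontier \<Omega> - (frontier \<Omega> - \<Gamma>D) = \<Gamma>D" using D by blast
    note bspec[OF conjunct2[OF traction[unfolded has_normal_trace_def, of i, unfolded this]] vH1[of i]]
    ultimately have "(\<integral>x. ?\<sigma> i x \<bullet> wgrad \<Omega> (?v i) x \<partial>?M) + (\<integral>x. wdiv \<Omega> (?\<sigma> i) x * v x $ i \<partial>?M)
        = (\<integral>x. (if x \<in> \<Gamma>T then s x $ i else 0) * ?b i x \<partial>surface (frontier \<Omega> - \<Gamma>D))"
      using zero[of i] by blast
    moreover have "(\<integral>x. wdiv \<Omega> (?\<sigma> i) x * v x $ i \<partial>?M) = - (\<integral>x. interp fmin (p x) * (f x $ i * v x $ i) \<partial>?M)"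
      using integral_cong_AE[OF meas meas' wdiv_eq] by simp
    moreover note surface_integral_traction[OF N D(2) frontier int_s zero, of i]
    ultimately show ?thesis by simp
  qed
  have "(\<integral>x. interp Emin (p x) * (stiffness E \<nu> (strain \<Omega> u x) \<bullet> strain \<Omega> v x) \<partial>?M)
      = (\<Sum>i\<in>UNIV. \<integral>x. ?\<sigma> i x \<bullet> wgrad \<Omega> (?v i) x \<partial>?M)"
    unfolding stress_inner_wjac[symmetric] by (rule Bochner_Integration.integral_sum) (rule int_\<sigma>)
  also have "\<dots> = (\<Sum>i\<in>UNIV. \<integral>x. s x $ i * ?b i x \<partial>surface \<Gamma>T)
      + (\<Sum>i\<in>UNIV. \<integral>x. interp fmin (p x) * (f x $ i * v x $ i) \<partial>?M)"
    unfolding component by (rule sum.distrib)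
  also have "(\<Sum>i\<in>UNIV. \<integral>x. s x $ i * ?b i x \<partial>surface \<Gamma>T) = (\<integral>x. s x \<bullet> btrace_vec \<Omega> v x \<partial>surface \<Gamma>T)"
    using int_s by (simp add: inner_vec_def btrace_vec_def)
  also have "(\<Sum>i\<in>UNIV. \<integral>x. interp fmin (p x) * (f x $ i * v x $ i) \<partial>?M)
      = (\<integral>x. interp fmin (p x) * (f x \<bullet> v x) \<partial>?M)"
    using int_f by (simp add: inner_vec_def sum_distrib_left)
  finally show ?thesis .
qed

section \<open>Energy dissipation\<close>

theorem theorem2p5:
  fixes \<Omega> \<Gamma>D \<Gamma>T :: "(real^'d) set"
    and f0 s :: "real^'d \<Rightarrow> real^'d"
    and \<gamma> \<epsilon> Emin fmin \<beta> E \<nu> :: real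
    and \<phi>0 :: "real^'d \<Rightarrow> real"
    and \<phi> dt_\<phi> \<eta> :: "real \<Rightarrow> real^'d \<Rightarrow> real"
    and u :: "real \<Rightarrow> real^'d \<Rightarrow> real^'d"
    and lam :: "real \<Rightarrow> real"
  assumes dim: "CARD('d) = 2 \<or> CARD('d) = 3"
    and domain: "lipschitz_domain \<Omega>"
    and Dirichlet_part: "\<Gamma>D \<subseteq> frontier \<Omega>" "\<Gamma>D \<in> sets borel"
    and Neumann_part: "\<Gamma>T \<subseteq> frontier \<Omega>" "\<Gamma>T \<in> sets borel"
    and body_force: "square_integrable (lebesgue_on \<Omega>) f0"
    and traction: "square_integrable (surface \<Gamma>T) s"
    and params: "\<gamma> > 0" "\<epsilon> > 0" "0 < Emin" "Emin < 1" "0 < fmin" "fmin < 1" "0 < \<beta>" "\<beta> < 1"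
    and material: "E > 0" "0 < \<nu>" "\<nu> < 1/2"
    and phi_H1: "\<And>t. t > 0 \<Longrightarrow> \<phi> t \<in> H1 \<Omega>"
    and phi_time: "\<And>t. t > 0 \<Longrightarrow> has_time_derivative \<Omega> \<phi> (dt_\<phi> t) t"
    and u_time: "\<And>t. t > 0 \<Longrightarrow> L2_tendsto (lebesgue_on \<Omega>) u (u t) (at t)"
    and eta_L2: "square_integrable (lebesgue_on ({0<..} \<times> \<Omega>)) (\<lambda>(t, x). \<eta> t x)"
    and elasticity: "\<And>t. t > 0 \<Longrightarrow> elasticity_solution \<Omega> \<Gamma>D \<Gamma>T Emin fmin E \<nu> f0 s (\<phi> t) (u t)"
    and laplacian_phi: "\<And>t. t > 0 \<Longrightarrow> weakly_divergent \<Omega> (wgrad \<Omega> (\<phi> t))"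
    and flow: "\<And>t. t > 0 \<Longrightarrow> AE x in lebesgue_on \<Omega>.
        dt_\<phi> t x = \<gamma> * \<epsilon> * wlaplacian \<Omega> (\<phi> t) x - \<gamma> / \<epsilon> * deriv double_well (\<phi> t x)
          + (deriv (interp Emin) (\<phi> t x) *\<^sub>R stiffness E \<nu> (strain \<Omega> (u t) x)) \<bullet> strain \<Omega> (u t) x
          - 2 * ((deriv (interp fmin) (\<phi> t x) *\<^sub>R f0 x) \<bullet> u t x)
          - lam t - \<eta> t x * (1 - 2 * \<phi> t x)"
    and initial: "AE x in lebesgue_on \<Omega>. \<phi> 0 x = \<phi>0 x"
    and Neumann_phi: "\<And>t. t > 0 \<Longrightarrow> has_normal_trace \<Omega> (frontier \<Omega>) (wgrad \<Omega> (\<phi> t)) (\<lambda>x. 0)"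
    and volume: "\<And>t. t > 0 \<Longrightarrow> lam t \<ge> 0"
      "\<And>t. t > 0 \<Longrightarrow> (\<integral>x. \<phi> t x \<partial>lebesgue_on \<Omega>) - \<beta> * measure lebesgue \<Omega> = 0"
      "\<And>t. t > 0 \<Longrightarrow> lam t * ((\<integral>x. \<phi> t x \<partial>lebesgue_on \<Omega>) - \<beta> * measure lebesgue \<Omega>) = 0"
    and bounds: "\<And>t. t > 0 \<Longrightarrow> AE x in lebesgue_on \<Omega>.
        \<eta> t x \<ge> 0 \<and> \<phi> t x * (1 - \<phi> t x) \<ge> 0 \<and> \<eta> t x * (\<phi> t x * (1 - \<phi> t x)) = 0"
  shows "\<forall>t>0.
      ((\<lambda>\<tau>. objective \<Omega> \<Gamma>T fmin \<gamma> \<epsilon> f0 s (\<phi> \<tau>) (u \<tau>)) has_real_derivative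
         - (L2_norm_on \<Omega> (dt_\<phi> t))\<^sup>2) (at t)
      \<and> - (L2_norm_on \<Omega> (dt_\<phi> t))\<^sup>2 \<le> 0"
proof (intro allI impI conjI)
  fix t :: real
  assume t: "t > 0"
  let ?M = "lebesgue_on \<Omega>"
  let ?\<psi> = "dt_\<phi> t" and ?U = "u t" and ?S = "\<lambda>\<tau>. strain \<Omega> (u \<tau>)"
  let ?A = "stiffness E \<nu> :: real^'d^'d \<Rightarrow> real^'d^'d"
  let ?l = "\<lambda>\<tau>. \<integral>x. s x \<bullet> btrace_vec \<Omega> (u \<tau>) x \<partial>surface \<Gamma>T"
  let ?GE = "interp Emin" and ?GF = "interp fmin" and ?W = double_well
  note GE = quadratic_remainder_interp[OF params(3,4)]
  note GF = quadratic_remainder_interp[OF params(5,6)]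
  note GW = quadratic_remainder_double_well

  have "\<Omega> \<in> lmeasurable"
    using domain by (auto simp: lipschitz_domain_def intro: lmeasurable_open)
  then interpret finite_measure ?M by (rule finite_measure_lebesgue_on)

  obtain C0 where psi_H1: "?\<psi> \<in> H1 \<Omega>"
    and derivative: "L2_tendsto ?M (\<lambda>h x. (\<phi> (t + h) x - \<phi> t x) / h) ?\<psi> (at 0)"
    and grad_derivative: "L2_tendsto ?M
       (\<lambda>h x. (1 / h) *\<^sub>R (wgrad \<Omega> (\<phi> (t + h)) x - wgrad \<Omega> (\<phi> t) x)) (wgrad \<Omega> ?\<psi>) (at 0)"
    and Lipschitz: "\<forall>\<^sub>F h in at 0. AE x in ?M. \<bar>\<phi> (t + h) x - \<phi> t x\<bar> \<le> C0 * \<bar>h\<bar>"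
    using phi_time[OF t] unfolding has_time_derivative_def by blast
  \<comment> \<open>The Lipschitz constant supplied by the hypothesis carries no sign, while the
    locale asks for a nonnegative one.\<close>
  define C where "C = max C0 0"
  have phi_meas: "\<phi> \<tau> \<in> borel_measurable ?M" if "\<tau> > 0" for \<tau>
    using square_integrable_measurable[OF square_integrable_H1[OF phi_H1[OF that]]] .
  have phi_range: "AE x in ?M. \<phi> \<tau> x \<in> {0..1}" if "\<tau> > 0" for \<tau>
    using bounds[OF that] by eventually_elim (auto simp: zero_le_mult_iff)
  interpret bounded_path ?M \<phi> ?\<psi> t C
  proof
    show "\<forall>\<^sub>F h in at 0. AE x in ?M. \<bar>\<phi> (t + h) x - \<phi> t x\<bar> \<le> C * \<bar>h\<bar>"
      using Lipschitz
    proof eventually_elim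
      case (elim h)
      then show ?case
      proof eventually_elim
        case (elim x)
        also have "C0 * \<bar>h\<bar> \<le> C * \<bar>h\<bar>" by (rule mult_right_mono) (simp_all add: C_def)
        finally show ?case .
      qed
    qed
    show "?\<psi> \<in> borel_measurable ?M"
      using square_integrable_measurable[OF square_integrable_H1[OF psi_H1]] .
  qed (use t derivative phi_meas phi_range in \<open>simp_all add: C_def\<close>)

  have u_space: "u \<tau> \<in> dirichlet_space \<Omega> \<Gamma>D" if "\<tau> > 0" for \<tau>
    using elasticity[OF that] by (simp add: elasticity_solution_def)
  note sq_U = square_integrable_dirichlet_space[OF u_space]
    and sq_S = square_integrable_strain[OF u_space]
  have U_lim: "L2_tendsto ?M (\<lambda>h. u (t + h)) (u t) (at 0)"
    using LIM_offset_zero[OF u_time[OF t, unfolded L2_tendsto_def]] by (simp add: L2_tendsto_def)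
  have interp_ge: "Emin \<le> ?GE a" if "a \<in> {0..1}" for a
    using params that by (simp add: interp_def)
  have mu: "2 * lame_mu E \<nu> > 0" using material by (simp add: lame_mu_def)
  note compliance = compliance_derivative[OF GE GF params(3) interp_ge bounded_linear_stiffness
      stiffness_symmetric mu stiffness_coercive[OF material] sq_S sq_U body_force U_lim
      elasticity_weak_form[OF Dirichlet_part Neumann_part body_force traction params(5,6)
        phi_meas phi_range elasticity u_space]]

  have sq_grad: "square_integrable ?M (wgrad \<Omega> (\<phi> \<tau>))" if "\<tau> > 0" for \<tau>
    by (rule square_integrable_wgrad[OF phi_H1[OF that]])
  have "\<forall>\<^sub>F h in at 0. square_integrable ?M (wgrad \<Omega> (\<phi> (t + h)))"
    using eventually_pos by eventually_elim (simp add: sq_grad)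
  note gradient = tendsto_norm_power2_quotient[where g = "\<lambda>\<tau>. wgrad \<Omega> (\<phi> \<tau>)",
      OF this sq_grad[OF t] square_integrable_wgrad[OF psi_H1] grad_derivative]
  have one: "integrable ?M (\<lambda>x. 1::real)" by simp
  note well = tendsto_integral_quotient_mult[OF GW one, unfolded mult_1_right]

  let ?IG = "\<integral>x. wgrad \<Omega> (\<phi> t) x \<bullet> wgrad \<Omega> ?\<psi> x \<partial>?M"
  let ?IW = "\<integral>x. deriv ?W (\<phi> t x) * ?\<psi> x \<partial>?M"
  let ?IE = "\<integral>x. deriv ?GE (\<phi> t x) * ?\<psi> x * (?A (?S t x) \<bullet> ?S t x) \<partial>?M"
  let ?IF = "\<integral>x. deriv ?GF (\<phi> t x) * ?\<psi> x * (f0 x \<bullet> ?U x) \<partial>?M"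
  let ?J = "\<lambda>\<tau>. objective \<Omega> \<Gamma>T fmin \<gamma> \<epsilon> f0 s (\<phi> \<tau>) (u \<tau>)"
  let ?cpl = "\<lambda>\<tau>. ?l \<tau> + (\<integral>x. ?GF (\<phi> \<tau> x) * (f0 x \<bullet> u \<tau> x) \<partial>?M)"
  let ?D = "\<lambda>\<tau>. \<integral>x. (norm (wgrad \<Omega> (\<phi> \<tau>) x))\<^sup>2 \<partial>?M" and ?P = "\<lambda>\<tau>. \<integral>x. ?W (\<phi> \<tau> x) \<partial>?M"
  have int_W: "integrable ?M (\<lambda>x. ?W (\<phi> \<tau> x))" if "\<tau> > 0" for \<tau>
    using integrable_comp_mult[OF GW that one] by simp
  have J: "?J \<tau> = ?cpl \<tau> + \<gamma> * (\<epsilon> / 2 * ?D \<tau> + 1 / \<epsilon> * ?P \<tau>)" if "\<tau> > 0" for \<tau>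
    using square_integrable_integrable[OF sq_grad[OF that]] int_W[OF that]
    by (simp add: objective_def)
  \<comment> \<open>So far the flow equation has played no part: this limit is the chain rule for
    the objective along any such path of equilibria.\<close>
  have "((\<lambda>h. (?cpl (t + h) - ?cpl t) / h + \<gamma> * (\<epsilon> / 2 * ((?D (t + h) - ?D t) / h)
        + 1 / \<epsilon> * (\<integral>x. (?W (\<phi> (t + h) x) - ?W (\<phi> t x)) / h \<partial>?M)))
      \<longlongrightarrow> (2 * ?IF - ?IE) + \<gamma> * (\<epsilon> / 2 * (2 * ?IG) + 1 / \<epsilon> * ?IW)) (at 0)"
    by (intro tendsto_add tendsto_mult tendsto_const compliance gradient well)
  moreover have "\<forall>\<^sub>F h in at 0. (?cpl (t + h) - ?cpl t) / h + \<gamma> * (\<epsilon> / 2 * ((?D (t + h) - ?D t) / h)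
        + 1 / \<epsilon> * (\<integral>x. (?W (\<phi> (t + h) x) - ?W (\<phi> t x)) / h \<partial>?M)) = (?J (t + h) - ?J t) / h"
    using eventually_pos
  proof eventually_elim
    case (elim h)
    have "(\<integral>x. (?W (\<phi> (t + h) x) - ?W (\<phi> t x)) / h \<partial>?M) = (?P (t + h) - ?P t) / h"
      using int_W[of "t + h"] int_W[OF t] elim by simp
    then show ?case
      using elim t by (simp only: J) (simp add: diff_divide_distrib algebra_simps add_divide_distrib)
  qed
  ultimately have deriv_J: "((\<lambda>h. (?J (t + h) - ?J t) / h)
      \<longlongrightarrow> (2 * ?IF - ?IE) + \<gamma> * (\<epsilon> / 2 * (2 * ?IG) + 1 / \<epsilon> * ?IW)) (at 0)"
    by (rule Lim_transform_eventually)

  \<comment> \<open>The integrals of the difference quotients tend to that of \<psi> and, the volume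
    being constant, vanish for small \<open>h\<close>.\<close>
  have psi_mean: "(\<integral>x. ?\<psi> x \<partial>?M) = 0"
  proof -
    have "((\<lambda>h. \<integral>x. (\<phi> (t + h) x - \<phi> t x) / h \<partial>?M) \<longlongrightarrow> (\<integral>x. ?\<psi> x \<partial>?M)) (at 0)"
      using tendsto_integral_quotient_mult[OF quadratic_remainder_ident one] by simp
    moreover have "((\<lambda>h. \<integral>x. (\<phi> (t + h) x - \<phi> t x) / h \<partial>?M) \<longlongrightarrow> 0) (at 0)"
    proof (rule tendsto_eventually)
      show "\<forall>\<^sub>F h in at 0. (\<integral>x. (\<phi> (t + h) x - \<phi> t x) / h \<partial>?M) = 0"
        using eventually_pos
      proof eventually_elim
        case (elim h)
        have "integrable ?M (\<phi> (t + h))" "integrable ?M (\<phi> t)"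
          using elim t by (auto intro: square_integrable_imp_integrable square_integrable_H1 phi_H1)
        then show ?case using volume(2)[of "t + h"] volume(2)[OF t] elim by simp
      qed
    qed
    ultimately show ?thesis by (rule tendsto_unique[rotated]) simp
  qed

  have div: "has_weak_divergence \<Omega> (wgrad \<Omega> (\<phi> t)) (wlaplacian \<Omega> (\<phi> t))"
    unfolding wlaplacian_def by (rule has_weak_divergence_wdiv[OF laplacian_phi[OF t]])
  then have "integrable ?M (wlaplacian \<Omega> (\<phi> t))"
    unfolding has_weak_divergence_def by blast
  \<comment> \<open>Boundedness of \<psi> makes the product with the merely integrable Laplacian
    integrable, as Green's formula demands.\<close>
  from integrable_bounded_mult[OF this psi_measurable psi_bounded]
  have int_lap: "integrable ?M (\<lambda>x. wlaplacian \<Omega> (\<phi> t) x * ?\<psi> x)" by (simp add: mult.commute)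
  have lap: "(\<integral>x. wlaplacian \<Omega> (\<phi> t) x * ?\<psi> x \<partial>?M) = - ?IG"
  proof -
    \<comment> \<open>The Neumann condition covers the whole boundary, so the set on which test
      functions must vanish is empty.\<close>
    have "AE x in surface (frontier \<Omega> - frontier \<Omega>). btrace \<Omega> ?\<psi> x = 0"
      by (rule AE_I2) (simp add: surface_def space_restrict_space)
    then have "?IG + (\<integral>x. wlaplacian \<Omega> (\<phi> t) x * ?\<psi> x \<partial>?M)
        = (\<integral>x. 0 * btrace \<Omega> ?\<psi> x \<partial>surface (frontier \<Omega>))"
      using Neumann_phi[OF t] psi_H1 int_lap unfolding has_normal_trace_def wlaplacian_def by blast
    then show ?thesis by simp
  qed

  have int_quot: "integrable ?M (\<lambda>x. deriv G (\<phi> t x) * ?\<psi> x * w x)"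
    if "quadratic_remainder G (deriv G) K" "integrable ?M w" for G K w
    by (rule integrable_bounded_mult[OF that(2) difference_quotient(2,3)[OF that(1)]])
  note int_psi = square_integrable_imp_integrable[OF square_integrable_psi]
  have int_AE: "integrable ?M (\<lambda>x. ?A (?S t x) \<bullet> ?S t x)"
    by (intro integrable_inner square_integrable_bounded_linear[OF bounded_linear_stiffness] sq_S t)
  note ints = int_lap int_quot[OF GW one, unfolded mult_1_right] int_quot[OF GE int_AE]
    int_quot[OF GF integrable_inner[OF body_force sq_U[OF t]]] int_psi
  have "AE x in ?M. (?\<psi> x)\<^sup>2 = \<gamma> * \<epsilon> * (wlaplacian \<Omega> (\<phi> t) x * ?\<psi> x)
      - \<gamma> / \<epsilon> * (deriv ?W (\<phi> t x) * ?\<psi> x) + deriv ?GE (\<phi> t x) * ?\<psi> x * (?A (?S t x) \<bullet> ?S t x)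
      - 2 * (deriv ?GF (\<phi> t x) * ?\<psi> x * (f0 x \<bullet> ?U x)) - lam t * ?\<psi> x"
    using flow[OF t] bounds[OF t] psi_eq_0
  proof eventually_elim
    case (elim x)
    \<comment> \<open>Complementarity gives \<eta> = 0 strictly between the bounds, and \<psi> = 0
      on them.\<close>
    then have "\<eta> t x * ?\<psi> x = 0" by auto
    then have eta: "\<eta> t x * (1 - 2 * \<phi> t x) * ?\<psi> x = 0" by auto
    have "(?\<psi> x)\<^sup>2 = (\<gamma> * \<epsilon> * wlaplacian \<Omega> (\<phi> t) x - \<gamma> / \<epsilon> * deriv ?W (\<phi> t x)
          + (deriv ?GE (\<phi> t x) *\<^sub>R ?A (?S t x)) \<bullet> ?S t x
          - 2 * ((deriv ?GF (\<phi> t x) *\<^sub>R f0 x) \<bullet> ?U x)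
          - lam t - \<eta> t x * (1 - 2 * \<phi> t x)) * ?\<psi> x"
      using elim(1) by (simp only: power2_eq_square)
    then show ?case
      unfolding left_diff_distrib distrib_right eta inner_scaleR_left by (simp add: ac_simps)
  qed
  then have "(\<integral>x. (?\<psi> x)\<^sup>2 \<partial>?M) = (\<integral>x. \<gamma> * \<epsilon> * (wlaplacian \<Omega> (\<phi> t) x * ?\<psi> x)
      - \<gamma> / \<epsilon> * (deriv ?W (\<phi> t x) * ?\<psi> x) + deriv ?GE (\<phi> t x) * ?\<psi> x * (?A (?S t x) \<bullet> ?S t x)
      - 2 * (deriv ?GF (\<phi> t x) * ?\<psi> x * (f0 x \<bullet> ?U x)) - lam t * ?\<psi> x \<partial>?M)"
    using ints square_integrable_integrable[OF square_integrable_psi]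
    by (intro integral_cong_AE borel_measurable_integrable Bochner_Integration.integrable_diff
        Bochner_Integration.integrable_add integrable_mult_right) auto
  also have "\<dots> = \<gamma> * \<epsilon> * (\<integral>x. wlaplacian \<Omega> (\<phi> t) x * ?\<psi> x \<partial>?M) - \<gamma> / \<epsilon> * ?IW + ?IE - 2 * ?IF
      - lam t * (\<integral>x. ?\<psi> x \<partial>?M)"
    using ints by simp
  \<comment> \<open>Green's formula replaces the Laplacian integral by \<open>- ?IG\<close> and the
    mean of \<psi> is 0; a change of sign then yields exactly the limit found in
    \<open>deriv_J\<close>.\<close>
  finally have "- (\<integral>x. (?\<psi> x)\<^sup>2 \<partial>?M) = (2 * ?IF - ?IE) + \<gamma> * (\<epsilon> / 2 * (2 * ?IG) + 1 / \<epsilon> * ?IW)"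
    unfolding lap psi_mean by (simp add: algebra_simps)
  moreover have "(L2_norm_on \<Omega> ?\<psi>)\<^sup>2 = (\<integral>x. (?\<psi> x)\<^sup>2 \<partial>?M)"
    by (simp add: L2_norm_on_def)
  ultimately show "(?J has_real_derivative - (L2_norm_on \<Omega> ?\<psi>)\<^sup>2) (at t)"
    using deriv_J by (simp only: DERIV_def)
qed simp

end
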